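(* Any two tree-shaped $n$-cubes have an $O(n^2)$-step grid refolding in which all intermediate manifolds are (possibly self-intersecting) tree-shaped $n$-cubes. That is, there is an absolute constant $K$ such that for every $n\ge 1$ and any two tree-shaped $n$-cubes $\mathcal P,\mathcal Q$, there is a sequence of at most $Kn^2$ grid refoldings transforming $\mathcal P$ into $\mathcal Q$ through (possibly self-intersecting) tree-shaped $n$-cubes. Moreover, if $\mathcal P$ and $\mathcal Q$ do not self-intersect and are slit-free, then the sequence can be chosen so that none of the intermediate manifolds self-intersects.
   Context: A *polyhedral manifold* is a connected two-dimensional surface made from finitely many flat polygons by gluing together (isometrically) paired portions of their boundary. *Gluing* joins together two equal-length portions of the remaining boundary. *Cutting* is the inverse operation: it splits a curve in the surface into two equal-length portions of boundary, while preserving the overall connectivity of the manifold. A *tree-shaped $n$-cube* is a polyhedral manifold formed from $n$ unit cubes of the cubical grid in $\mathbb R^3$, joined face-to-face in a tree structure (the dual graph, with a node for each cube and an edge for each join, is a tree). When two cubes are joined at a common face, that face is removed from the manifold, so the resulting surface is homeomorphic to a sphere (and has surface area $4n+2$). Two cubes may be adjacent in space (share a face) without being joined, in which case there are two surface squares between them. A tree-shaped $n$-cube is *slit-free* if there are no two such touching but unjoined cubes. Multiple cubes are also allowed to occupy the same location in space, in which case the tree-shaped $n$-cube is called *self-intersecting*. *Grid cutting* is cutting restricted to edges of the cubical grid (edges of the unit cubes). A *grid refolding* (step) is a grid cutting, leaving the surface connected, followed by a gluing that results in another tree-shaped $n$-cube. A *$k$-step grid refolding* is a sequence of $k$ such steps.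 *)

theory Defs
  imports Main "HOL-Library.Product_Plus"
begin

section \<open>Tree-shaped cubes\<close>

text \<open>Unit cubes of the cubical grid are identified with points of the integer lattice; the six
  unit vectors name the faces of a cube by their outward normals.\<close>

type_synonym vec = "int \<times> int \<times> int"

definition dirs :: "vec set" where
  "dirs = {(1,0,0), (-1,0,0), (0,1,0), (0,-1,0), (0,0,1), (0,0,-1)}"

definition perp :: "vec \<Rightarrow> vec \<Rightarrow> bool" where
  "perp a b \<longleftrightarrow> a \<in> dirs \<and> b \<in> dirs \<and> a \<noteq> b \<and> a \<noteq> - b"

definition share_face :: "vec \<Rightarrow> vec \<Rightarrow> bool" where
  "share_face u v \<longleftrightarrow> v - u \<in> dirs"

text \<open>Undirected graphs are symmetric irreflexive relations.\<close>

definition undirected_graph :: "'a set \<Rightarrow> 'a rel \<Rightarrow> bool" where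
  "undirected_graph V E \<longleftrightarrow> finite V \<and> E \<subseteq> V \<times> V \<and> sym E \<and> irrefl E"

definition graph_connected :: "'a set \<Rightarrow> 'a rel \<Rightarrow> bool" where
  "graph_connected V E \<longleftrightarrow> V \<noteq> {} \<and> (\<forall>u\<in>V. \<forall>v\<in>V. (u, v) \<in> E\<^sup>*)"

definition graph_cycle :: "'a rel \<Rightarrow> 'a list \<Rightarrow> bool" where
  "graph_cycle E vs \<longleftrightarrow> 3 \<le> length vs \<and> distinct vs \<and>
     (\<forall>k < length vs. (vs ! k, vs ! (Suc k mod length vs)) \<in> E)"

definition graph_tree :: "'a set \<Rightarrow> 'a rel \<Rightarrow> bool" where
  "graph_tree V E \<longleftrightarrow> undirected_graph V E \<and> graph_connected V E \<and> \<not> (\<exists>vs. graph_cycle E vs)"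

text \<open>A complex of n cubes has the cubes 0, ..., n - 1; cube i sits at \<open>pos i\<close>. Distinct cubes may
  sit at the same place.\<close>

record polycube =
  pos :: "nat \<Rightarrow> vec"
  joins :: "nat rel"

definition joined :: "polycube \<Rightarrow> nat \<Rightarrow> vec \<Rightarrow> nat \<Rightarrow> bool" where
  "joined P i a j \<longleftrightarrow> (i, j) \<in> joins P \<and> pos P j = pos P i + a"

text \<open>The last conjunct says that a face is consumed by at most one join. It only matters for
  cubes in the same location: a face that has been removed cannot be joined again.\<close>

definition tree_shaped :: "nat \<Rightarrow> polycube \<Rightarrow> bool" where
  "tree_shaped n P \<longleftrightarrow>
     graph_tree {..<n} (joins P) \<and>
     (\<forall>(i, j) \<in> joins P. share_face (pos P i) (pos P j)) \<and>
     (\<forall>i a j k. joined P i a j \<and> joined P i a k \<longrightarrow> j = k)"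

definition self_intersecting :: "nat \<Rightarrow> polycube \<Rightarrow> bool" where
  "self_intersecting n P \<longleftrightarrow> (\<exists>i<n. \<exists>j<n. i \<noteq> j \<and> pos P i = pos P j)"

definition slit_free :: "nat \<Rightarrow> polycube \<Rightarrow> bool" where
  "slit_free n P \<longleftrightarrow>
     \<not> (\<exists>i<n. \<exists>j<n. share_face (pos P i) (pos P j) \<and> (i, j) \<notin> joins P)"

section \<open>Polyhedral manifolds made of unit squares\<close>

text \<open>A square is labelled by a pair (i, a); its four sides are labelled by the four directions
  perpendicular to a. The flag (i, a, b, e) is the side b of the square (i, a) together with that
  endpoint of the side that is shared with the side e. An isometric identification of
  two sides is given by identifying the flags on one with the flags on the other.\<close>

type_synonym flag = "nat \<times> vec \<times> vec \<times> vec"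

record surface =
  squares :: "(nat \<times> vec) set"
  gluing :: "flag rel"

definition flags :: "surface \<Rightarrow> flag set" where
  "flags S = {(i, a, b, e). (i, a) \<in> squares S \<and> perp a b \<and> perp a e \<and> perp b e}"

fun other_end :: "flag \<Rightarrow> flag" where
  "other_end (i, a, b, e) = (i, a, b, - e)"

fun other_side :: "flag \<Rightarrow> flag" where
  "other_side (i, a, b, e) = (i, a, e, b)"

text \<open>Connectivity is connectivity through glued sides: squares that merely have a corner in common
  are not connected by it.\<close>

definition surface_connected :: "surface \<Rightarrow> bool" where
  "surface_connected S \<longleftrightarrow> flags S \<noteq> {} \<and>
     (\<forall>x \<in> flags S. \<forall>y \<in> flags S.
        (x, y) \<in> ({(z, other_end z) | z. z \<in> flags S} \<union> {(z, other_side z) | z. z \<in> flags S}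
                  \<union> gluing S)\<^sup>*)"

text \<open>Each side is glued to at most one side, which is a different one; unglued sides form the
  boundary.\<close>

definition grid_manifold :: "surface \<Rightarrow> bool" where
  "grid_manifold S \<longleftrightarrow>
     finite (squares S) \<and> (\<forall>(i, a) \<in> squares S. a \<in> dirs) \<and>
     gluing S \<subseteq> flags S \<times> flags S \<and> sym (gluing S) \<and> single_valued (gluing S) \<and>
     (\<forall>(x, y) \<in> gluing S. (other_end x, other_end y) \<in> gluing S \<and> y \<noteq> x \<and> y \<noteq> other_end x) \<and>
     surface_connected S"

definition isometric :: "surface \<Rightarrow> surface \<Rightarrow> bool" where
  "isometric S T \<longleftrightarrow> (\<exists>f. bij_betw f (flags S) (flags T) \<and>
     (\<forall>x \<in> flags S. f (other_end x) = other_end (f x) \<and> f (other_side x) = other_side (f x)) \<and>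
     (\<forall>x \<in> flags S. \<forall>y \<in> flags S. (x, y) \<in> gluing S \<longleftrightarrow> (f x, f y) \<in> gluing T))"

text \<open>\<open>grid_cutting S S'\<close>: the surface S' arises from S by cutting along some grid edges. Gluing is
  the inverse operation.\<close>

definition grid_cutting :: "surface \<Rightarrow> surface \<Rightarrow> bool" where
  "grid_cutting S S' \<longleftrightarrow> grid_manifold S \<and> grid_manifold S' \<and>
     squares S' = squares S \<and> gluing S' \<subseteq> gluing S"

definition grid_gluing :: "surface \<Rightarrow> surface \<Rightarrow> bool" where
  "grid_gluing S S' \<longleftrightarrow> grid_cutting S' S"

section \<open>The surface of a tree-shaped cube\<close>

definition exposed :: "polycube \<Rightarrow> nat \<Rightarrow> vec \<Rightarrow> bool" where
  "exposed P i a \<longleftrightarrow> (\<nexists>j. joined P i a j)"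

text \<open>\<open>hinge P (i, a, b) (j, c, d)\<close> holds if the side b of the face a of cube i coincides in the
  surface with the side d of the exposed face c of cube j. To find the latter, turn about the edge
  that the faces a and b of cube i have in common: if the face b is exposed, it is the answer. If it
  was removed in a join with a cube k, that cube has the edge on its faces - b and a, and the search
  goes on from its face - b. Only joins are crossed, so that slits have two sides.\<close>

inductive hinge :: "polycube \<Rightarrow> nat \<times> vec \<times> vec \<Rightarrow> nat \<times> vec \<times> vec \<Rightarrow> bool" for P where
  "exposed P i b \<Longrightarrow> hinge P (i, a, b) (i, b, a)"
| "joined P i b k \<Longrightarrow> hinge P (k, - b, a) s \<Longrightarrow> hinge P (i, a, b) s"

text \<open>Both glued sides are the same edge in space, so endpoints in the same direction e are
  identified.\<close>

definition surface_of :: "nat \<Rightarrow> polycube \<Rightarrow> surface" where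
  "surface_of n P =
     (let Q = {(i, a). i < n \<and> a \<in> dirs \<and> exposed P i a};
          F = flags \<lparr>squares = Q, gluing = {}\<rparr>
      in \<lparr>squares = Q,
          gluing = {((i, a, b, e), (j, c, d, e')). (i, a, b, e) \<in> F \<and> (j, c, d, e') \<in> F \<and>
                      hinge P (i, a, b) (j, c, d) \<and> e' = e}\<rparr>)"

section \<open>Grid refoldings\<close>

definition grid_refolding :: "nat \<Rightarrow> polycube \<Rightarrow> polycube \<Rightarrow> bool" where
  "grid_refolding n P Q \<longleftrightarrow> tree_shaped n P \<and> tree_shaped n Q \<and>
     (\<exists>S T. grid_cutting (surface_of n P) S \<and> grid_gluing S T \<and> isometric T (surface_of n Q))"

definition grid_refolding_seq :: "nat \<Rightarrow> nat \<Rightarrow> (nat \<Rightarrow> polycube) \<Rightarrow> polycube \<Rightarrow> polycube \<Rightarrow> bool" where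
  "grid_refolding_seq n k M P Q \<longleftrightarrow> M 0 = P \<and> M k = Q \<and>
     (\<forall>i\<le>k. tree_shaped n (M i)) \<and> (\<forall>i<k. grid_refolding n (M i) (M (Suc i)))"

end

(* A leaf cube that sits on a face of the remaining cube tree can be moved over any edge of that
   face by one refolding: the surfaces before and after differ by a shift of four consecutive squares
   around the edge, and stay connected when cut where they differ. Since the surface of the remaining tree
   is connected, a leaf can be brought to any face by O(n) moves. Let u be a cube with largest first coordinate;
   bringing the leaves one by one to the top of a tower that grows from u in that
   direction turns the tree into a straight line after O(n^2) moves, and moves are reversible. In a slit-free tree
   without self-intersections, the place in front of an exposed face is empty, and this persists
   while the tower grows, so that no self-intersection arises. *)

theory Submission
  imports Defs
begin

text \<open>The obstacle is the connectedness of the cut surface. Squares that border the face under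
  the leaf, or the square over the edge, in the two directions parallel to the edge lose their
  contact with the moved squares, and need a detour. The detour turns about a corner of that face.
  It comes back because the rotation is injective on finitely many flags. That it does not run into
  the square over the edge is where the tree enters: every join is a bridge, and the rotation stays
  on one side of the bridge. Positions alone could not show this, because distinct cubes may share a
  place; walks about an edge are therefore followed along joins.

  For the last claim, only the tree without the moving leaf is kept slit-free. The leaf itself may
  touch other cubes on its way, but it always finds an empty place.

  The towers reached from two trees agree only up to labels and a translation. Since refoldings
  compare surfaces up to isometry, one further refolding that cuts nothing identifies them.\<close>

declare split_paired_All [simp del] split_paired_Ex [simp del]

section \<open>Directions, orthogonal frames and orientation\<close>

fun dot :: "vec \<Rightarrow> vec \<Rightarrow> int" where
  "dot (a, b, c) (x, y, z) = a * x + b * y + c * z"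

lemma dot_add [simp]: "dot u (v + w) = dot u v + dot u w"
  by (cases u; cases v; cases w) (simp add: algebra_simps)

lemma dot_minus [simp]: "dot u (- v) = - dot u v"
  by (cases u; cases v) simp

lemma dot_diff [simp]: "dot u (v - w) = dot u v - dot u w"
  by (cases u; cases v; cases w) (simp add: algebra_simps)

lemma dot_self: "a \<in> dirs \<Longrightarrow> dot a a = 1"
  by (auto simp: dirs_def)

lemma perp_dot: "perp a b \<Longrightarrow> dot a b = 0"
  by (auto simp: perp_def dirs_def)

lemma dirs_uminus [simp]: "- a \<in> dirs \<longleftrightarrow> a \<in> dirs"
  by (cases a) (auto simp: dirs_def)

lemma dirs_neq_uminus: "a \<in> dirs \<Longrightarrow> a \<noteq> - a"
  by (auto simp: dirs_def)

lemma finite_dirs: "finite dirs" and card_dirs: "card dirs = 6"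
  by (auto simp: dirs_def)

lemma perp_sym: "perp a b \<Longrightarrow> perp b a"
  by (auto simp: perp_def)

lemma perp_uminus [simp]: "perp (- a) b \<longleftrightarrow> perp a b" "perp a (- b) \<longleftrightarrow> perp a b"
  by (auto simp: perp_def)

lemma perp_dirs: "perp a b \<Longrightarrow> a \<in> dirs" "perp a b \<Longrightarrow> b \<in> dirs"
  by (auto simp: perp_def)

lemma perp_neq:
  assumes "perp a b"
  shows "a \<noteq> b" "b \<noteq> a" "a \<noteq> - b" "b \<noteq> - a" "- a \<noteq> b" "- b \<noteq> a" "a \<noteq> - a" "b \<noteq> - b" "- a \<noteq> a" "- b \<noteq> b"
  using assms dirs_neq_uminus[of a] dirs_neq_uminus[of b] by (auto simp: perp_def)

lemma dirs_cases: "a \<in> dirs \<Longrightarrow> b \<in> dirs \<Longrightarrow> b = a \<or> b = - a \<or> perp a b"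
  by (auto simp: perp_def)

text \<open>Counting: the signed vectors of a frame are six distinct directions, and there are only
  six.\<close>

lemma frame_cases:
  assumes "perp a b" "perp a e" "perp b e" "x \<in> dirs"
  shows "x = a \<or> x = - a \<or> x = b \<or> x = - b \<or> x = e \<or> x = - e"
proof (rule ccontr)
  assume "\<not> ?thesis"
  moreover have "card {a, - a, b, - b, e, - e} = 6"
    using perp_neq[OF assms(1)] perp_neq[OF assms(2)] perp_neq[OF assms(3)] by simp
  moreover have "{a, - a, b, - b, e, - e} \<subseteq> dirs"
    using assms perp_dirs by auto
  ultimately show False
    using card_subset_eq[OF finite_dirs, of "{a, - a, b, - b, e, - e}"] assms(4) card_dirs by auto
qed

lemma ex_perp2: "perp a b \<Longrightarrow> \<exists>e. perp a e \<and> perp b e"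
proof -
  assume ab: "perp a b"
  have "\<forall>a\<in>dirs. \<forall>b\<in>dirs. perp a b \<longrightarrow> (\<exists>e\<in>dirs. perp a e \<and> perp b e)"
    by (simp add: dirs_def perp_def)
  then show ?thesis using ab perp_dirs by blast
qed

text \<open>The determinant with the three arguments as rows. On flags (normal, side, endpoint) its
  sign is the orientation, which makes a rotation about a corner meet a square in one way
  only.\<close>

fun det3 :: "vec \<Rightarrow> vec \<Rightarrow> vec \<Rightarrow> int" where
  "det3 (a, b, c) (x, y, z) (u, v, w) = a * (y * w - z * v) - b * (x * w - z * u) + c * (x * v - y * u)"

lemma det3_minus [simp]:
  "det3 (- a) b c = - det3 a b c" "det3 a (- b) c = - det3 a b c" "det3 a b (- c) = - det3 a b c"
  by (cases a; cases b; cases c; simp add: algebra_simps)+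

lemma det3_swap: "det3 b a c = - det3 a b c" "det3 a c b = - det3 a b c"
  by (cases a; cases b; cases c; simp add: algebra_simps)+

lemma det3_nonzero:
  assumes "perp a b" "perp a c" "perp b c" shows "det3 a b c \<noteq> 0"
proof -
  have "\<forall>a\<in>dirs. \<forall>b\<in>dirs. \<forall>c\<in>dirs. perp a b \<longrightarrow> perp a c \<longrightarrow> perp b c \<longrightarrow> det3 a b c \<noteq> 0"
    by (simp add: dirs_def perp_def)
  then show ?thesis using assms perp_dirs by blast
qed

text \<open>The four quarter turns of the ordered pair \<open>(a, b)\<close> in its plane: the pairs
  (face, side) that can occur on a walk about one edge.\<close>

definition turned :: "vec \<Rightarrow> vec \<Rightarrow> vec \<Rightarrow> vec \<Rightarrow> bool" where
  "turned a b x y \<longleftrightarrow> (x, y) \<in> {(a, b), (- b, a), (- a, - b), (b, - a)}"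

lemma turned_refl: "turned a b a b"
  by (simp add: turned_def)

lemma turned_step: "turned a b x y \<Longrightarrow> turned a b (- y) x"
  by (auto simp: turned_def)

lemma turned_perp: "turned a b x y \<Longrightarrow> perp a b \<Longrightarrow> perp x y"
  by (auto simp: turned_def intro: perp_sym)

lemma turned_perp3: "turned a b x y \<Longrightarrow> perp a e \<Longrightarrow> perp b e \<Longrightarrow> perp x e \<and> perp y e"
  by (auto simp: turned_def intro: perp_sym)

lemma turned_det3: "turned a b x y \<Longrightarrow> det3 x y e = det3 a b e"
  using det3_swap(1)[of a b e] by (auto simp: turned_def)

section \<open>Hinges\<close>

text \<open>Twice the midpoint of the side b of the face a of cube i.\<close>

definition edge :: "polycube \<Rightarrow> nat \<times> vec \<times> vec \<Rightarrow> vec" where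
  "edge P = (\<lambda>(i, a, b). pos P i + pos P i + a + b)"

lemma joined_turn:
  assumes "joined P i b k"
  shows "edge P (k, - b, a) = edge P (i, a, b)"
  using assms by (simp add: joined_def edge_def algebra_simps)

lemma hinge_edge: "hinge P s t \<Longrightarrow> edge P t = edge P s"
proof (induction rule: hinge.induct)
  case (1 i b a) then show ?case by (simp add: edge_def algebra_simps)
next
  case (2 i b k a s) then show ?case using joined_turn by simp
qed

text \<open>The components of \<open>t\<close> appear swapped because the last step of a walk
  exchanges face and side instead of making another quarter turn.\<close>

lemma hinge_turned_aux:
  "hinge P s t \<Longrightarrow> turned a b (fst (snd s)) (snd (snd s)) \<Longrightarrow> turned a b (snd (snd t)) (fst (snd t))"
  by (induction rule: hinge.induct) (auto dest: turned_step)

lemma hinge_turned: "hinge P (i, a, b) (j, c, d) \<Longrightarrow> turned a b d c"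
  using hinge_turned_aux[of P "(i, a, b)" "(j, c, d)" a b] by (simp add: turned_refl)

lemma hinge_perp:
  assumes "hinge P (i, a, b) (j, c, d)" "perp a b" shows "perp c d"
  using turned_perp[OF hinge_turned[OF assms(1)] assms(2)] by (rule perp_sym)

lemma hinge_perp3:
  assumes "hinge P (i, a, b) (j, c, d)" "perp a e" "perp b e" shows "perp c e" "perp d e"
  using turned_perp3[OF hinge_turned[OF assms(1)] assms(2,3)] by auto

text \<open>The sign flips because a common side is seen with opposite orientations from its two
  squares; this is the orientability of the surface.\<close>

lemma hinge_det3:
  assumes "hinge P (i, a, b) (j, c, d)" shows "det3 c d e = - det3 a b e"
  using turned_det3[OF hinge_turned[OF assms], of e] det3_swap(1)[of c d e] by simp

lemma hinge_exposed: "hinge P s t \<Longrightarrow> exposed P (fst t) (fst (snd t))"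
  by (induction rule: hinge.induct) auto

lemma exposed_joined: "exposed P i a \<Longrightarrow> joined P i a j \<Longrightarrow> False"
  by (auto simp: exposed_def)

text \<open>The third clause of \<open>tree_shaped\<close>. It makes walks about an edge
  deterministic.\<close>

definition face_simple :: "polycube \<Rightarrow> bool" where
  "face_simple P \<longleftrightarrow> (\<forall>i a j k. joined P i a j \<and> joined P i a k \<longrightarrow> j = k)"

lemma hinge_unique:
  assumes "face_simple P" "hinge P s t" "hinge P s t'" shows "t' = t"
  using assms(2,3)
proof (induction arbitrary: t' rule: hinge.induct)
  case (1 i b a)
  from 1(2) 1(1) show ?case by (cases rule: hinge.cases) (auto dest: exposed_joined)
next
  case (2 i b k a s)
  from 2(4) show ?case
  proof (cases rule: hinge.cases)
    case 1 then show ?thesis using 2(1) exposed_joined by blast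
  next
    case (2 k')
    moreover have "k' = k"
      using assms(1) 2(1) \<open>joined P i b k\<close> unfolding face_simple_def by blast
    ultimately show ?thesis using "2.IH" by auto
  qed
qed

lemma joined_sym: "sym (joins P) \<Longrightarrow> joined P i a j \<Longrightarrow> joined P j (- a) i"
  by (auto simp: joined_def dest: symD)

text \<open>Generalised for the induction: \<open>r\<close> is the end of the walk that sets out
  from \<open>s\<close> in the opposite sense. Retracing the walk from \<open>t\<close> leads back
  to \<open>s\<close> and on to \<open>r\<close>. Symmetry is the case in which the opposite walk
  stops at once.\<close>

lemma hinge_reverse:
  assumes "sym (joins P)" "hinge P s t"
  shows "hinge P (fst s, snd (snd s), fst (snd s)) r \<Longrightarrow> hinge P t r"
  using assms(2)
proof (induction arbitrary: r rule: hinge.induct)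
  case (1 i b a) then show ?case by simp
next
  case (2 i b k a s)
  have "hinge P (k, a, - b) r"
    using joined_sym[OF assms(1) 2(1)] 2(4) by (auto intro: hinge.intros(2)[where k = i])
  then show ?case using 2(3) by simp
qed

lemma hinge_sym:
  assumes "sym (joins P)" "exposed P i a" "hinge P (i, a, b) t" shows "hinge P t (i, a, b)"
  using hinge_reverse[OF assms(1,3), of "(i, a, b)"] assms(2) by (simp add: hinge.intros(1))

section \<open>Cube trees grown leaf by leaf\<close>

text \<open>The position of \<open>l\<close> is overwritten, so \<open>attach P p a l\<close> and
  \<open>attach P q c l\<close> describe the same leaf before and after a move, over the same
  \<open>P\<close>.\<close>

definition attach :: "polycube \<Rightarrow> nat \<Rightarrow> vec \<Rightarrow> nat \<Rightarrow> polycube" where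
  "attach P p a l = P\<lparr>pos := (pos P)(l := pos P p + a), joins := joins P \<union> {(p, l), (l, p)}\<rparr>"

lemma pos_attach: "pos (attach P p a l) = (pos P)(l := pos P p + a)"
  and joins_attach: "joins (attach P p a l) = joins P \<union> {(p, l), (l, p)}"
  by (simp_all add: attach_def)

text \<open>The label set is explicit, since removing a leaf need not leave an initial segment. The
  root \<open>u\<close> is a parameter because the tower will stand on it; it is never
  removed.\<close>

inductive cube_tree :: "nat \<Rightarrow> nat set \<Rightarrow> polycube \<Rightarrow> bool" for u where
  root: "joins P = {} \<Longrightarrow> cube_tree u {u} P"
| leaf: "cube_tree u V P \<Longrightarrow> p \<in> V \<Longrightarrow> l \<notin> V \<Longrightarrow> a \<in> dirs \<Longrightarrow> exposed P p a \<Longrightarrow>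
    cube_tree u (insert l V) (attach P p a l)"

lemma joined_attach:
  assumes "joins P \<subseteq> V \<times> V" "p \<in> V" "l \<notin> V"
  shows "joined (attach P p a l) i x j \<longleftrightarrow>
    joined P i x j \<or> i = p \<and> j = l \<and> x = a \<or> i = l \<and> j = p \<and> x = - a"
proof -
  have "(i, j) \<in> joins P \<Longrightarrow> i \<noteq> l \<and> j \<noteq> l" "p \<noteq> l" using assms by auto
  moreover have "u = u + a + x \<longleftrightarrow> x = - a" for u :: vec
    by (cases u; cases a; cases x) auto
  ultimately show ?thesis
    by (auto simp: joined_def pos_attach joins_attach)
qed

lemma joined_mem: "joins P \<subseteq> V \<times> V \<Longrightarrow> joined P i x j \<Longrightarrow> i \<in> V \<and> j \<in> V"
  by (auto simp: joined_def)

lemma exposed_attach: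
  assumes "joins P \<subseteq> V \<times> V" "p \<in> V" "l \<notin> V"
  shows "exposed (attach P p a l) i x \<longleftrightarrow>
    (if i = l then x \<noteq> - a else exposed P i x \<and> (i, x) \<noteq> (p, a))"
proof -
  have "\<not> joined P l x j" for j using assms(1,3) joined_mem by blast
  then show ?thesis using assms(2,3) by (auto simp: exposed_def joined_attach[OF assms])
qed

lemma cube_tree_basic:
  assumes "cube_tree u V P"
  shows "finite V" "u \<in> V" "joins P \<subseteq> V \<times> V" "sym (joins P)" "irrefl (joins P)" "face_simple P"
    "\<forall>(i, j) \<in> joins P. share_face (pos P i) (pos P j)"
proof -
  have "finite V \<and> u \<in> V \<and> joins P \<subseteq> V \<times> V \<and> sym (joins P) \<and> irrefl (joins P) \<and> face_simple P \<and>
    (\<forall>(i, j) \<in> joins P. share_face (pos P i) (pos P j))"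
    using assms
  proof induction
    case (root P)
    then show ?case by (simp add: face_simple_def joined_def sym_def irrefl_def)
  next
    case (leaf V P p l a)
    note J = joined_attach[of P V p l a]
    have "\<not> joined P p a j" "\<not> joined P l x j" for x j
      using leaf by (auto simp: exposed_def joined_def)
    then have "face_simple (attach P p a l)"
      using leaf J unfolding face_simple_def by metis
    moreover have "share_face (pos (attach P p a l) i) (pos (attach P p a l) j)"
      if "(i, j) \<in> joins (attach P p a l)" for i j
    proof -
      have "(i, j) \<in> joins P \<Longrightarrow> i \<noteq> l \<and> j \<noteq> l" "p \<noteq> l" using leaf by auto
      moreover have "pos P p - (pos P p + a) = - a" by (simp add: algebra_simps)
      ultimately show ?thesis using that leaf
        by (auto simp: joins_attach pos_attach share_face_def)
    qed
    ultimately show ?case using leaf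
      by (auto simp: joins_attach sym_def irrefl_def)
  qed
  then show "finite V" "u \<in> V" "joins P \<subseteq> V \<times> V" "sym (joins P)" "irrefl (joins P)" "face_simple P"
    "\<forall>(i, j) \<in> joins P. share_face (pos P i) (pos P j)" by blast+
qed

text \<open>Every join of a tree is a bridge, and \<open>X\<close> is the side of \<open>p\<close>.
  In this form the absence of cycles enters the geometry.\<close>

lemma cube_tree_bridge:
  assumes "cube_tree u V P" "(p, k) \<in> joins P"
  obtains X where "p \<in> X" "k \<notin> X" "\<And>i j. (i, j) \<in> joins P \<Longrightarrow> i \<in> X \<Longrightarrow> j \<notin> X \<Longrightarrow> i = p \<and> j = k"
proof -
  have "\<exists>X. p \<in> X \<and> k \<notin> X \<and> (\<forall>i j. (i, j) \<in> joins P \<and> i \<in> X \<and> j \<notin> X \<longrightarrow> i = p \<and> j = k)"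
    using assms
  proof (induction arbitrary: p k)
    case (root P) then show ?case by simp
  next
    case (leaf V P p' l a)
    have V: "joins P \<subseteq> V \<times> V" using cube_tree_basic[OF leaf(1)] by simp
    consider "(p, k) \<in> joins P" | "p = p'" "k = l" | "p = l" "k = p'"
      using leaf.prems by (auto simp: joins_attach)
    then show ?case
    proof cases
      case 1
      then obtain X where X: "p \<in> X" "k \<notin> X"
        "\<And>i j. (i, j) \<in> joins P \<Longrightarrow> i \<in> X \<Longrightarrow> j \<notin> X \<Longrightarrow> i = p \<and> j = k" using leaf.IH by metis
      have "p \<noteq> l" "k \<noteq> l" "p' \<noteq> l" using 1 V leaf by auto
      \<comment> \<open>The new leaf goes to the side of its parent.\<close>
      then show ?thesis using X V leaf(2,3)
        by (intro exI[of _ "if p' \<in> X then insert l X else X - {l}"]) (auto simp: joins_attach)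
    next
      case 2
      then show ?thesis using V leaf(2,3)
        by (intro exI[of _ V]) (auto simp: joins_attach)
    next
      case 3
      then show ?thesis using V leaf(2,3)
        by (intro exI[of _ "{l}"]) (auto simp: joins_attach)
    qed
  qed
  then show ?thesis using that by blast
qed

lemma hinge_mem:
  assumes "hinge P s t" "joins P \<subseteq> V \<times> V" "fst s \<in> V" shows "fst t \<in> V"
  using assms(1,3) by (induction rule: hinge.induct) (use joined_mem[OF assms(2)] in auto)

text \<open>Among the old faces only \<open>(p, a)\<close> ceases to be exposed, and a walk needs an
  exposed face only at its end.\<close>

lemma hinge_attach_other:
  assumes "joins P \<subseteq> V \<times> V" "p \<in> V" "l \<notin> V"
    and "hinge P s t" "fst s \<in> V" "(fst t, fst (snd t)) \<noteq> (p, a)"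
  shows "hinge (attach P p a l) s t"
  using assms(4-6)
proof (induction rule: hinge.induct)
  case (1 i b x)
  then show ?case using assms by (auto intro!: hinge.intros(1) simp: exposed_attach[OF assms(1-3)])
next
  case (2 i b k x s)
  then show ?case using joined_mem[OF assms(1)]
    by (auto intro!: hinge.intros(2)[where k = k] simp: joined_attach[OF assms(1-3)])
qed

text \<open>Where the walk used to stop at \<open>(p, a)\<close>, it now crosses into the leaf and
  stops at the wall that rises from the side \<open>w\<close>.\<close>

lemma hinge_attach_face:
  assumes "joins P \<subseteq> V \<times> V" "p \<in> V" "l \<notin> V" and "hinge P s t" "fst s \<in> V"
    and "perp (fst (snd s)) (snd (snd s))" "t = (p, a, w)"
  shows "hinge (attach P p a l) s (l, w, - a)"
  using assms(4-7)
proof (induction rule: hinge.induct)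
  case (1 i b x)
  then have *: "i = p" "b = a" "x = w" "perp a w" using perp_sym[of x b] by simp_all
  then have "hinge (attach P p a l) (l, - a, w) (l, w, - a)"
    using perp_neq[of a w] by (auto intro!: hinge.intros(1) simp: exposed_attach[OF assms(1-3)])
  then show ?case using *
    by (auto intro!: hinge.intros(2)[where k = l] simp: joined_attach[OF assms(1-3)])
next
  case (2 i b k x s)
  have "perp b x" using 2(5) perp_sym by simp
  moreover have "k \<in> V" using joined_mem[OF assms(1) 2(1)] by simp
  ultimately have "hinge (attach P p a l) (k, - b, x) (l, w, - a)" using 2 by simp
  moreover have "joined (attach P p a l) i b k" using 2(1) by (simp add: joined_attach[OF assms(1-3)])
  ultimately show ?case by (metis hinge.intros(2))
qed

text \<open>The wall takes over the neighbour that \<open>(p, a)\<close> had across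
  \<open>x\<close>: the walk from the foot of the wall first crosses the join back to
  \<open>p\<close>.\<close>

lemma hinge_attach_wall:
  assumes "joins P \<subseteq> V \<times> V" "p \<in> V" "l \<notin> V" and "hinge (attach P p a l) (p, a, x) t"
  shows "hinge (attach P p a l) (l, x, - a) t"
proof -
  have "joined (attach P p a l) l (- a) p" by (simp add: joined_attach[OF assms(1-3)])
  then show ?thesis using hinge.intros(2) assms(4) by (metis minus_minus)
qed

lemma hinge_attach_leaf:
  assumes "joins P \<subseteq> V \<times> V" "p \<in> V" "l \<notin> V" "y \<noteq> - a"
  shows "hinge (attach P p a l) (l, x, y) (l, y, x)"
  by (rule hinge.intros(1)) (simp add: exposed_attach[OF assms(1-3)] assms(4))
text \<open>By \<open>hinge_turned\<close>, a return to the same face would be over its opposite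
  side \<open>- b\<close>, whereas a walk stays at one edge in space.\<close>

lemma hinge_other_face:
  assumes "hinge P (i, a, b) (j, c, d)" "perp a b" shows "(j, c) \<noteq> (i, a)"
proof
  assume *: "(j, c) = (i, a)"
  then have "d = - b" using hinge_turned[OF assms(1)] perp_neq[OF assms(2)] by (auto simp: turned_def)
  then have "b = - b" using hinge_edge[OF assms(1)] * by (simp add: edge_def)
  then show False using perp_neq[OF assms(2)] by simp
qed

text \<open>A new leaf prolongs only the walks that ended at \<open>(p, a)\<close>, and these by a
  single crossing. A walk that starts on the leaf stops at once or continues as the one from
  \<open>(p, a)\<close>.\<close>

lemma hinge_total:
  assumes "cube_tree u V P" "i \<in> V" "exposed P i x" "perp x y"
  shows "\<exists>t. hinge P (i, x, y) t"
  using assms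
proof (induction arbitrary: i x y)
  case (root P)
  then have "exposed P i y" by (simp add: exposed_def joined_def)
  then show ?case by (blast intro: hinge.intros(1))
next
  case (leaf V P p l a)
  note V = cube_tree_basic(3)[OF leaf(1)] leaf(2,3)
  note ex = exposed_attach[OF V]
  have old: "\<exists>t. hinge (attach P p a l) (i, x, y) t"
    if "i \<in> V" "exposed P i x" "perp x y" for i x y
  proof -
    have "\<exists>t. hinge P (i, x, y) t" using leaf.IH[OF that] .
    then obtain t where t: "hinge P (i, x, y) t" ..
    show ?thesis
    proof (cases "(fst t, fst (snd t)) = (p, a)")
      case True
      then have "t = (p, a, snd (snd t))" by (metis fst_conv prod.collapse snd_conv)
      then show ?thesis using hinge_attach_face[OF V t, of a "snd (snd t)"] that by auto
    next
      case False
      then show ?thesis using hinge_attach_other[OF V t, of a] that by auto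
    qed
  qed
  show ?case
  proof (cases "i = l")
    case False
    then show ?thesis using leaf.prems old by (simp add: ex)
  next
    case True
    show ?thesis
    proof (cases "y = - a")
      case False
      then show ?thesis using True hinge_attach_leaf[OF V] by blast
    next
      case y: True
      then have "perp a x" using leaf.prems(3) perp_sym by simp
      then obtain t where "hinge (attach P p a l) (p, a, x) t" using old leaf(2,5) by blast
      then show ?thesis using hinge_attach_wall[OF V] True y by blast
    qed
  qed
qed

section \<open>The surface of a cube tree\<close>

text \<open>\<open>surface_of\<close> for an arbitrary label set, so that the tree without its leaf
  has a surface as well.\<close>

definition surface_on :: "nat set \<Rightarrow> polycube \<Rightarrow> surface" where
  "surface_on V P =
     (let Q = {(i, a). i \<in> V \<and> a \<in> dirs \<and> exposed P i a};
          F = flags \<lparr>squares = Q, gluing = {}\<rparr>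
      in \<lparr>squares = Q,
          gluing = {((i, a, b, e), (j, c, d, e')). (i, a, b, e) \<in> F \<and> (j, c, d, e') \<in> F \<and>
                      hinge P (i, a, b) (j, c, d) \<and> e' = e}\<rparr>)"

lemma surface_of_eq: "surface_of n P = surface_on {..<n} P"
  by (simp add: surface_of_def surface_on_def)

lemma squares_on: "(i, a) \<in> squares (surface_on V P) \<longleftrightarrow> i \<in> V \<and> a \<in> dirs \<and> exposed P i a"
  by (simp add: surface_on_def Let_def)

lemma flags_on:
  "(i, a, b, e) \<in> flags (surface_on V P) \<longleftrightarrow>
     i \<in> V \<and> exposed P i a \<and> perp a b \<and> perp a e \<and> perp b e"
  using perp_dirs(1)[of a b] by (auto simp: flags_def squares_on)

text \<open>A hinge that starts at a flag ends at one, so the conditions on the second flag follow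
  from those on the first.\<close>

lemma gluing_on:
  assumes "joins P \<subseteq> V \<times> V"
  shows "((i, a, b, e), (j, c, d, e')) \<in> gluing (surface_on V P) \<longleftrightarrow>
     i \<in> V \<and> exposed P i a \<and> perp a b \<and> perp a e \<and> perp b e \<and> hinge P (i, a, b) (j, c, d) \<and> e' = e"
proof -
  have "j \<in> V \<and> exposed P j c \<and> perp c d \<and> perp c e \<and> perp d e"
    if "i \<in> V" "exposed P i a" "perp a b" "perp a e" "perp b e" "hinge P (i, a, b) (j, c, d)"
    using that hinge_mem[OF that(6) assms] hinge_exposed[OF that(6)] hinge_perp[OF that(6,3)]
      hinge_perp3[OF that(6,4,5)] by simp
  moreover have "((i, a, b, e), (j, c, d, e')) \<in> gluing (surface_on V P) \<longleftrightarrow>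
    (i, a, b, e) \<in> flags (surface_on V P) \<and> (j, c, d, e') \<in> flags (surface_on V P) \<and>
                      hinge P (i, a, b) (j, c, d) \<and> e' = e"
    by (simp add: surface_on_def Let_def flags_def)
  ultimately show ?thesis by (auto simp: flags_on)
qed

section \<open>Adjacency of squares and connectedness of surfaces\<close>

definition adjacent :: "surface \<Rightarrow> (nat \<times> vec) rel" where
  "adjacent S = {((i, x), (j, y)). \<exists>u e w e'. ((i, x, u, e), (j, y, w, e')) \<in> gluing S}"

lemma adjacentI: "((i, x, u, e), (j, y, w, e')) \<in> gluing S \<Longrightarrow> ((i, x), (j, y)) \<in> adjacent S"
  by (auto simp: adjacent_def)

lemma sym_adjacent: "sym (gluing S) \<Longrightarrow> sym (adjacent S)"
  unfolding adjacent_def sym_def by blast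

lemma adjacent_on:
  assumes "joins P \<subseteq> V \<times> V"
  shows "((i, x), (j, y)) \<in> adjacent (surface_on V P) \<longleftrightarrow>
    i \<in> V \<and> exposed P i x \<and> (\<exists>u w. perp x u \<and> hinge P (i, x, u) (j, y, w))"
proof
  assume "((i, x), (j, y)) \<in> adjacent (surface_on V P)"
  then show "i \<in> V \<and> exposed P i x \<and> (\<exists>u w. perp x u \<and> hinge P (i, x, u) (j, y, w))"
    unfolding adjacent_def by (auto simp: gluing_on[OF assms])
next
  assume R: "i \<in> V \<and> exposed P i x \<and> (\<exists>u w. perp x u \<and> hinge P (i, x, u) (j, y, w))"
  then obtain u w where "perp x u" "hinge P (i, x, u) (j, y, w)" by blast
  moreover then obtain e where "perp x e" "perp u e" using ex_perp2 by blast
  ultimately show "((i, x), (j, y)) \<in> adjacent (surface_on V P)"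
    using R by (intro adjacentI[of i x u e j y w e]) (simp add: gluing_on[OF assms])
qed

lemma adjacent_onI:
  assumes "joins P \<subseteq> V \<times> V" "i \<in> V" "exposed P i x" "perp x u" "hinge P (i, x, u) (j, y, w)"
  shows "((i, x), (j, y)) \<in> adjacent (surface_on V P)"
  using assms adjacent_on[OF assms(1)] by blast

text \<open>\<open>other_end\<close> and \<open>other_side\<close> act on the eight flags of a
  square as two reflections that generate its dihedral group, and this group is transitive on the
  flags.\<close>

lemma flags_same_square:
  assumes "(i, a, b, e) \<in> flags S" "(i, a, b', e') \<in> flags S"
    and "\<And>z. z \<in> flags S \<Longrightarrow> (z, other_end z) \<in> R" "\<And>z. z \<in> flags S \<Longrightarrow> (z, other_side z) \<in> R"
  shows "((i, a, b, e), (i, a, b', e')) \<in> R\<^sup>*"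
proof -
  have s: "(i, a) \<in> squares S" and p: "perp a b" "perp a e" "perp b e"
    and p': "perp a b'" "perp a e'" "perp b' e'"
    using assms(1,2) by (auto simp: flags_def)
  have E: "((i, a, x, y), (i, a, x, - y)) \<in> R" and S: "((i, a, x, y), (i, a, y, x)) \<in> R"
    if "perp a x" "perp a y" "perp x y" for x y
    using s that assms(3)[of "(i, a, x, y)"] assms(4)[of "(i, a, x, y)"] by (auto simp: flags_def)
  have N: "((i, a, x, y), (i, a, - x, y)) \<in> R\<^sup>*" if "perp a x" "perp a y" "perp x y" for x y
    using S[of x y] E[of y x] S[of y "- x"] that perp_sym[OF that(3)]
    by (meson converse_rtrancl_into_rtrancl perp_uminus r_into_rtrancl)
  have all: "((i, a, x, y), (i, a, x', y')) \<in> R\<^sup>*"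
    if "perp a x" "perp a y" "perp x y" "x' = x \<or> x' = - x" "y' = y \<or> y' = - y" for x y x' y'
    using that E[of x y] E[of "- x" y] N[of x y] by (auto intro: rtrancl_into_rtrancl)
  have b': "b' = b \<or> b' = - b \<or> b' = e \<or> b' = - e"
    using frame_cases[OF p perp_dirs(2)[OF p'(1)]] perp_neq[OF p'(1)] by auto
  have e': "e' = b \<or> e' = - b \<or> e' = e \<or> e' = - e"
    using frame_cases[OF p perp_dirs(2)[OF p'(2)]] perp_neq[OF p'(2)] by auto
  have "(b' = b \<or> b' = - b) \<and> (e' = e \<or> e' = - e) \<or> (b' = e \<or> b' = - e) \<and> (e' = b \<or> e' = - b)"
    using b' e' perp_neq[OF p'(3)] by auto
  then show ?thesis
  proof
    assume "(b' = b \<or> b' = - b) \<and> (e' = e \<or> e' = - e)"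
    then show ?thesis using all[OF p] by blast
  next
    assume "(b' = e \<or> b' = - e) \<and> (e' = b \<or> e' = - b)"
    then have "((i, a, e, b), (i, a, b', e')) \<in> R\<^sup>*"
      using all[OF p(2,1) perp_sym[OF p(3)]] by blast
    then show ?thesis using S[OF p] by (rule converse_rtrancl_into_rtrancl[rotated])
  qed
qed

text \<open>All flags of one square are connected, so connectedness may be checked on the graph of
  squares, and there by reaching one fixed square.\<close>

lemma surface_connectedI:
  assumes "(i0, x0) \<in> squares S" "perp x0 y0" "sym (gluing S)" "gluing S \<subseteq> flags S \<times> flags S"
    and conn: "\<And>i x. (i, x) \<in> squares S \<Longrightarrow> ((i, x), (i0, x0)) \<in> (adjacent S)\<^sup>*"
  shows "surface_connected S"
proof -
  define R where "R = {(z, other_end z) | z. z \<in> flags S} \<union> {(z, other_side z) | z. z \<in> flags S} \<union> gluing S"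
  have R: "\<And>z. z \<in> flags S \<Longrightarrow> (z, other_end z) \<in> R" "\<And>z. z \<in> flags S \<Longrightarrow> (z, other_side z) \<in> R"
    by (auto simp: R_def)
  have step: "((i, x, b, e), (j, y, b', e')) \<in> R\<^sup>*"
    if "(f, g) \<in> (adjacent S)\<^sup>*" "f = (i, x)" "g = (j, y)" "(i, x, b, e) \<in> flags S" "(j, y, b', e') \<in> flags S"
    for f g i x b e j y b' e'
    using that
  proof (induction arbitrary: j y b' e')
    case base
    then show ?case using flags_same_square[OF _ _ R] by auto
  next
    case (step g h)
    obtain k z where g: "g = (k, z)" by (cases g)
    obtain u w v w' where gl: "((k, z, u, w), (j, y, v, w')) \<in> gluing S"
      using step.hyps(2) g step.prems(2) by (auto simp: adjacent_def)
    then have fl: "(k, z, u, w) \<in> flags S" "(j, y, v, w') \<in> flags S" using assms(4) by auto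
    have "((i, x, b, e), (k, z, u, w)) \<in> R\<^sup>*" using step.IH[OF step.prems(1) g step.prems(3) fl(1)] .
    also have "((k, z, u, w), (j, y, v, w')) \<in> R\<^sup>*" using gl by (auto simp: R_def)
    also have "((j, y, v, w'), (j, y, b', e')) \<in> R\<^sup>*"
      using flags_same_square[OF fl(2) step.prems(4) R] by simp
    finally show ?case .
  qed
  have "(X, Y) \<in> R\<^sup>*" if XY: "X \<in> flags S" "Y \<in> flags S" for X Y
  proof -
    obtain i x b e j y b' e' where [simp]: "X = (i, x, b, e)" "Y = (j, y, b', e')"
      by (cases X, cases Y)
    have "((i, x), (i0, x0)) \<in> (adjacent S)\<^sup>*" "((i0, x0), (j, y)) \<in> (adjacent S)\<^sup>*"
      using conn[of i x] conn[of j y] sym_rtrancl[OF sym_adjacent[OF assms(3)]] XY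
      by (auto simp: flags_def dest: symD)
    then have "((i, x), (j, y)) \<in> (adjacent S)\<^sup>*" by (rule rtrancl_trans)
    then show ?thesis using step[OF _ refl refl] XY by simp
  qed
  moreover obtain e where "perp x0 e" "perp y0 e" using ex_perp2[OF assms(2)] by blast
  then have "(i0, x0, y0, e) \<in> flags S" using assms by (auto simp: flags_def)
  ultimately show ?thesis unfolding surface_connected_def R_def by blast
qed

lemma sym_gluing_on:
  assumes "cube_tree u V P" shows "sym (gluing (surface_on V P))"
proof (rule symI)
  note V = cube_tree_basic[OF assms]
  fix X Y assume XY: "(X, Y) \<in> gluing (surface_on V P)"
  obtain i a b e j c d e' where [simp]: "X = (i, a, b, e)" "Y = (j, c, d, e')"
    by (cases X, cases Y)
  have h: "i \<in> V" "exposed P i a" "perp a b" "perp a e" "perp b e" "hinge P (i, a, b) (j, c, d)" "e' = e"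
    using XY by (simp_all add: gluing_on[OF V(3)])
  then show "(Y, X) \<in> gluing (surface_on V P)"
    using hinge_mem[OF h(6) V(3)] hinge_exposed[OF h(6)] hinge_perp[OF h(6,3)]
      hinge_perp3[OF h(6,4,5)] hinge_sym[OF V(4) h(2,6)] by (simp add: gluing_on[OF V(3)])
qed

lemma ex_perp: "a \<in> dirs \<Longrightarrow> \<exists>b. perp a b"
proof -
  assume a: "a \<in> dirs"
  have "\<forall>a\<in>dirs. \<exists>b\<in>dirs. perp a b" by (simp add: dirs_def perp_def)
  then show ?thesis using a by blast
qed

text \<open>A path of squares survives the growth of a leaf if each visit to the covered square
  \<open>(p, a)\<close> becomes a visit to the top \<open>(l, a)\<close>, entered and left over the
  wall at the side concerned.\<close>

lemma adjacent_connected: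
  assumes "cube_tree u V P" "(i, x) \<in> squares (surface_on V P)" "(j, y) \<in> squares (surface_on V P)"
  shows "((i, x), (j, y)) \<in> (adjacent (surface_on V P))\<^sup>*"
proof -
  have "\<exists>f. \<forall>i x. (i, x) \<in> squares (surface_on V P) \<longrightarrow> ((i, x), f) \<in> (adjacent (surface_on V P))\<^sup>*"
    using assms(1)
  proof induction
    case (root P)
    have ex: "exposed P i x" for i x using root by (simp add: exposed_def joined_def)
    have J: "joins P \<subseteq> {u} \<times> {u}" using root by simp
    have adj: "((u, x), (u, y)) \<in> adjacent (surface_on {u} P)" if "perp x y" for x y
      unfolding adjacent_on[OF J] using ex that hinge.intros(1)[of P u y x] by blast
    define a :: vec where "a = (1, 0, 0)"
    have a: "a \<in> dirs" by (simp add: a_def dirs_def)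
    then obtain b where b: "perp a b" using ex_perp by blast
    have "((u, x), (u, a)) \<in> (adjacent (surface_on {u} P))\<^sup>*" if xd: "x \<in> dirs" for x
    proof -
      consider "x = a" | "x = - a" | "perp x a" using dirs_cases[of a x] a xd perp_sym by blast
      then show ?thesis
      proof cases
        case 2
        have "((u, x), (u, b)) \<in> adjacent (surface_on {u} P)" "((u, b), (u, a)) \<in> adjacent (surface_on {u} P)"
          using b 2 perp_sym[OF b] by (auto intro!: adj)
        then show ?thesis by simp
      qed (use adj[of x a] in auto)
    qed
    then show ?case by (intro exI[of _ "(u, a)"]) (auto simp: squares_on)
  next
    case (leaf V P p l a)
    let ?A = "adjacent (surface_on V P)" and ?A' = "adjacent (surface_on (insert l V) (attach P p a l))"
    have T: "cube_tree u (insert l V) (attach P p a l)" using leaf by (intro cube_tree.leaf)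
    note V = cube_tree_basic(3)[OF leaf(1)] leaf(2,3)
    note ex = exposed_attach[OF V]
    note J = cube_tree_basic(3)[OF T]
    note sym = sym_adjacent[OF sym_gluing_on[OF T]]
    obtain f where f: "\<And>i x. (i, x) \<in> squares (surface_on V P) \<Longrightarrow> ((i, x), f) \<in> ?A\<^sup>*"
      using leaf.IH by blast
    have top: "((l, w), (l, a)) \<in> ?A'" if "perp a w" for w
      using perp_neq[OF that] perp_sym[OF that]
      by (intro adjacent_onI[OF J _ _ _ hinge_attach_leaf[OF V]]) (auto simp: ex)
    have pf: "(p, a) \<in> squares (surface_on V P)" using leaf by (simp add: squares_on)
    \<comment> \<open>The \<open>if\<close> carries out this replacement at the end of the path; the
      start is not replaced and so must differ from \<open>(p, a)\<close>.\<close>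
    have tr: "g \<noteq> (p, a) \<longrightarrow> (g, if h = (p, a) then (l, a) else h) \<in> ?A'\<^sup>*"
      if "(g, h) \<in> ?A\<^sup>*" for g h
      using that
    proof (induction rule: rtrancl_induct)
      case base
      then show ?case by simp
    next
      case (step h k)
      obtain i x j y where [simp]: "h = (i, x)" "k = (j, y)" by (cases h, cases k)
      obtain v w where h: "i \<in> V" "exposed P i x" "perp x v" "hinge P (i, x, v) (j, y, w)"
        using step.hyps(2) by (auto simp: adjacent_on[OF V(1)])
      have "(if h = (p, a) then (l, a) else h, if k = (p, a) then (l, a) else k) \<in> ?A'\<^sup>*"
      proof (cases "h = (p, a)")
        case True
        then have [simp]: "i = p" "x = a" by auto
        have k: "k \<noteq> (p, a)" using hinge_other_face[OF h(4,3)] by simp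
        have "hinge (attach P p a l) (l, v, - a) (j, y, w)"
          using hinge_attach_other[OF V h(4), of a] k h(1) by (intro hinge_attach_wall[OF V]) simp
        then have "((l, v), k) \<in> ?A'"
          unfolding \<open>k = _\<close> using perp_neq[OF h(3)] perp_sym[OF h(3)]
          by (intro adjacent_onI[OF J]) (auto simp: ex)
        moreover have "((l, a), (l, v)) \<in> ?A'" using top[of v] h(3) symD[OF sym] by simp
        ultimately show ?thesis using True k by simp
      next
        case hf: False
        show ?thesis
        proof (cases "k = (p, a)")
          case True
          then have [simp]: "j = p" "y = a" by auto
          have "hinge (attach P p a l) (i, x, v) (l, w, - a)"
            using hinge_attach_face[OF V h(4)] h by simp
          then have "(h, (l, w)) \<in> ?A'"
            unfolding \<open>h = _\<close> using h hf V by (intro adjacent_onI[OF J]) (auto simp: ex)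
          moreover have "((l, w), (l, a)) \<in> ?A'" using top hinge_perp[OF h(4,3)] by simp
          ultimately show ?thesis using True hf by simp
        next
          case False
          have "hinge (attach P p a l) (i, x, v) (j, y, w)"
            using hinge_attach_other[OF V h(4)] False h by simp
          then have "(h, k) \<in> ?A'"
            unfolding \<open>h = _\<close> \<open>k = _\<close> using h hf V by (intro adjacent_onI[OF J]) (auto simp: ex)
          then show ?thesis using False hf by auto
        qed
      qed
      then show ?case using step.IH by (meson rtrancl_trans)
    qed
    have "((i, x), (l, a)) \<in> ?A'\<^sup>*" if sq: "(i, x) \<in> squares (surface_on (insert l V) (attach P p a l))" for i x
    proof (cases "i = l")
      case True
      then have "x = a \<or> perp a x" using sq dirs_cases[of a x] leaf(4) by (auto simp: squares_on ex)
      then show ?thesis using top[of x] True by auto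
    next
      case False
      then have ix: "(i, x) \<in> squares (surface_on V P)" "(i, x) \<noteq> (p, a)"
        using sq by (auto simp: squares_on ex)
      have "((i, x), (p, a)) \<in> ?A\<^sup>*"
        using f[OF ix(1)] f[OF pf] symD[OF sym_rtrancl[OF sym_adjacent[OF sym_gluing_on[OF leaf(1)]]]]
        by (meson rtrancl_trans)
      then show ?thesis using tr[of "(i, x)" "(p, a)"] ix(2) by simp
    qed
    then show ?case by blast
  qed
  then show ?thesis
    using assms(2,3) symD[OF sym_rtrancl[OF sym_adjacent[OF sym_gluing_on[OF assms(1)]]]]
    by (meson rtrancl_trans)
qed

lemma ex_exposed: "cube_tree u V P \<Longrightarrow> \<exists>i x. i \<in> V \<and> x \<in> dirs \<and> exposed P i x"
proof (induction rule: cube_tree.induct)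
  case (root P)
  then show ?case by (intro exI[of _ u] exI[of _ "(1, 0, 0)"]) (simp add: dirs_def exposed_def joined_def)
next
  case (leaf V P p l a)
  note V = cube_tree_basic(3)[OF leaf(1)] leaf(2,3)
  show ?case using leaf(4) dirs_neq_uminus[OF leaf(4)]
    by (intro exI[of _ l] exI[of _ a]) (simp add: exposed_attach[OF V])
qed

lemma grid_manifold_on:
  assumes T: "cube_tree u V P"
  shows "grid_manifold (surface_on V P)"
proof -
  note V = cube_tree_basic[OF T]
  let ?S = "surface_on V P"
  have "squares ?S \<subseteq> V \<times> dirs" by (auto simp: squares_on)
  then have "finite (squares ?S)" using V(1) finite_dirs by (meson finite_SigmaI finite_subset)
  moreover have sub: "gluing ?S \<subseteq> flags ?S \<times> flags ?S" 
    by (auto simp: surface_on_def Let_def flags_def)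
  moreover have "single_valued (gluing ?S)"
    using hinge_unique[OF V(6)] by (fastforce simp: single_valued_def gluing_on[OF V(3)])
  moreover have "(other_end x, other_end y) \<in> gluing ?S \<and> y \<noteq> x \<and> y \<noteq> other_end x"
    if xy: "(x, y) \<in> gluing ?S" for x y
  proof -
    obtain i a b e j c d e' where [simp]: "x = (i, a, b, e)" "y = (j, c, d, e')" by (cases x, cases y)
    have g: "i \<in> V" "exposed P i a" "perp a b" "perp a e" "perp b e" "hinge P (i, a, b) (j, c, d)" "e' = e"
      using xy by (simp_all add: gluing_on[OF V(3)])
    then show ?thesis using hinge_other_face[OF g(6,3)] by (auto simp: gluing_on[OF V(3)])
  qed
  moreover have "surface_connected ?S"
  proof -
    obtain i0 x0 where "i0 \<in> V" "x0 \<in> dirs" "exposed P i0 x0" using ex_exposed[OF T] by blast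
    moreover then obtain y0 where "perp x0 y0" using ex_perp by blast
    ultimately have t: "(i0, x0) \<in> squares ?S" "perp x0 y0" by (auto simp: squares_on)
    then show ?thesis
      using surface_connectedI[OF t sym_gluing_on[OF T] sub adjacent_connected[OF T _ t(1)]] by simp
  qed
  moreover have "\<forall>(i, a) \<in> squares ?S. a \<in> dirs" by (auto simp: squares_on)
  ultimately show ?thesis using sym_gluing_on[OF T] unfolding grid_manifold_def by blast
qed

text \<open>A walk over hinges crosses the join of p and k at most once: a second crossing would take
  place at a different edge in space.\<close>

lemma hinge_stays_out:
  assumes "hinge P s t" "sym (joins P)" "pos P k = pos P p + b" "perp a b"
    and X: "\<And>i j. (i, j) \<in> joins P \<Longrightarrow> i \<in> X \<Longrightarrow> j \<notin> X \<Longrightarrow> i = p \<and> j = k"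
    and "fst s \<notin> X" "edge P s = edge P (p, a, b)" "turned a b (fst (snd s)) (snd (snd s))"
  shows "fst t \<notin> X"
  using assms(1,6-8)
proof (induction rule: hinge.induct)
  case (1 i y x)
  then show ?case by simp
next
  case (2 i y m x s)
  have "m \<notin> X"
  proof
    assume m: "m \<in> X"
    have "(m, i) \<in> joins P" using 2(1) assms(2) by (auto simp: joined_def dest: symD)
    then have [simp]: "m = p" "i = k" using X[of m i] m 2(4) by auto
    have "pos P p = pos P k + y" using 2(1) by (simp add: joined_def)
    then have y: "y = - b" using assms(3) by (simp add: eq_neg_iff_add_eq_0 add.commute add.left_commute)
    then have "x = - a" using 2(6) perp_neq[OF assms(4)] by (auto simp: turned_def)
    then have "a + a = 0" using 2(5) y assms(3) by (simp add: edge_def algebra_simps)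
    then have "a = - a" by (simp add: eq_neg_iff_add_eq_0)
    then show False using perp_neq[OF assms(4)] by simp
  qed
  then show ?case using 2 joined_turn[OF 2(1)] turned_step by simp
qed

text \<open>If the walk stops at once, then \<open>(q, c)\<close> is \<open>(p, b)\<close> and
  \<open>X\<close> can be everything. Otherwise the first crossing is a bridge, and by
  \<open>hinge_stays_out\<close> the walk never returns over it.\<close>

lemma hinge_separation:
  assumes T: "cube_tree u V P" and h: "hinge P (p, a, b) (q, c, d)" "perp a b"
  obtains X where "p \<in> X" "q \<in> X \<Longrightarrow> q = p \<and> c = b"
    "\<And>i y j. joined P i y j \<Longrightarrow> i \<in> X \<Longrightarrow> j \<notin> X \<Longrightarrow> i = p \<and> y = b"
  using h(1)
proof (cases rule: hinge.cases)
  case 1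
  show ?thesis by (rule that[of UNIV]) (use 1 in simp_all)
next
  case (2 k)
  have pk: "(p, k) \<in> joins P" "pos P k = pos P p + b" using 2(1) by (simp_all add: joined_def)
  obtain X where X: "p \<in> X" "k \<notin> X"
    "\<And>i j. (i, j) \<in> joins P \<Longrightarrow> i \<in> X \<Longrightarrow> j \<notin> X \<Longrightarrow> i = p \<and> j = k"
    using cube_tree_bridge[OF T pk(1)] by blast
  have "q \<notin> X"
    using hinge_stays_out[OF 2(2) cube_tree_basic(4)[OF T] pk(2) h(2) X(3)] X(2)
      joined_turn[OF 2(1), of a] turned_step[OF turned_refl] by simp
  moreover have "i = p \<and> y = b" if "joined P i y j" "i \<in> X" "j \<notin> X" for i y j
    using that X(3)[of i j] pk(2) by (auto simp: joined_def)
  ultimately show ?thesis using that X(1) by blast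
qed

definition hinge_of :: "polycube \<Rightarrow> nat \<times> vec \<times> vec \<Rightarrow> nat \<times> vec \<times> vec" where
  "hinge_of P s = (SOME t. hinge P s t)"

lemma hinge_of_eq: "face_simple P \<Longrightarrow> hinge P s t \<Longrightarrow> hinge_of P s = t"
  unfolding hinge_of_def using hinge_unique by (metis someI)

text \<open>The walk is about an edge that ends at the corner of \<open>(p, a)\<close> between
  \<open>- b\<close> and \<open>e\<close>; in doubled coordinates \<open>z\<close> leads from the
  midpoint of the edge to this corner. The only way out of \<open>X\<close> is through the face
  \<open>b\<close> of \<open>p\<close>, on the far side of that cube: the components along
  \<open>b\<close> would be both \<open>1\<close> and \<open>- 1\<close>.\<close>

lemma hinge_stays_in:
  assumes "hinge P s t" "perp a b" "perp a e" "perp b e"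
    and X: "\<And>i y j. joined P i y j \<Longrightarrow> i \<in> X \<Longrightarrow> j \<notin> X \<Longrightarrow> i = p \<and> y = b"
    and "fst s \<in> X" "edge P s + z = pos P p + pos P p + a - b + e"
    and "perp (fst (snd s)) (snd (snd s))" "perp (fst (snd s)) z" "perp (snd (snd s)) z"
  shows "fst t \<in> X"
  using assms(1,6-)
proof (induction rule: hinge.induct)
  case (1 i y x)
  then show ?case by simp
next
  case (2 i y m x s)
  have "m \<in> X"
  proof (rule ccontr)
    assume "m \<notin> X"
    then have [simp]: "i = p" "y = b" using X[OF 2(1)] 2(4) by auto
    have "x + b + z = a - b + e" using 2(5) by (simp add: edge_def algebra_simps)
    then have "dot b (x + b + z) = dot b (a - b + e)" by simp
    moreover have "dot b x = 0" "dot b z = 0" "dot b a = 0" "dot b e = 0" "dot b b = 1"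
      using 2(6-8) assms(2-4) perp_dot perp_sym perp_dirs dot_self by auto
    ultimately show False by simp
  qed
  then show ?case using 2 joined_turn[OF 2(1)] perp_sym by simp
qed

definition adjacent_avoiding :: "surface \<Rightarrow> (nat \<times> vec) set \<Rightarrow> (nat \<times> vec) rel" where
  "adjacent_avoiding S B = {(s, t) \<in> adjacent S. s \<notin> B \<and> t \<notin> B}"

text \<open>Turning about the corner of the face (p, a) between its sides - b and e leads from the
  neighbour over e to the neighbour over - b. The rotation permutes the flags at that corner;
  it cannot meet (q, c), because it does not cross the join over the side b, and
  orientation makes it meet (p, a) only once.\<close>

lemma corner:
  assumes T: "cube_tree u V P" and p: "p \<in> V" "exposed P p a"
    and ab: "perp a b" and ae: "perp a e" and be: "perp b e"
    and g: "hinge P (p, a, b) (q, c, d)"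
    and r: "hinge P (p, a, e) (r, x, y)" and r': "hinge P (p, a, - b) (r', x', y')"
  shows "((r, x), (r', x')) \<in> (adjacent_avoiding (surface_on V P) {(p, a), (q, c)})\<^sup>*"
    and "(r', x') \<notin> {(p, a), (q, c)}"
proof -
  note V = cube_tree_basic[OF T]
  obtain X where X: "p \<in> X" "q \<in> X \<Longrightarrow> q = p \<and> c = b"
    "\<And>i y j. joined P i y j \<Longrightarrow> i \<in> X \<Longrightarrow> j \<notin> X \<Longrightarrow> i = p \<and> y = b"
    using hinge_separation[OF T g ab] by blast
  define v where "v = pos P p + pos P p + a - b + e"
  \<comment> \<open>Flags at the corner \<open>v\<close>, on the cubes of \<open>X\<close>, with the
    orientation of the start. The position \<open>v\<close> does not single out a vertex of the
    surface, because unrelated cubes may meet there too.\<close>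
  define I :: "flag set" where "I = {(i, x, y, z). i \<in> V \<and> exposed P i x \<and> i \<in> X \<and> perp x y \<and> perp x z \<and> perp y z \<and>
    pos P i + pos P i + x + y + z = v \<and> det3 x y z = det3 a (- b) e}"
  \<comment> \<open>One step of the rotation crosses the side \<open>z\<close>; the other side
    \<open>y\<close> of the corner is crossed next.\<close>
  define \<rho> :: "flag \<Rightarrow> flag" where "\<rho> = (\<lambda>(i, x, y, z). case hinge_of P (i, x, z) of (j, x', z') \<Rightarrow> (j, x', z', y))"
  define B where "B = {(p, a), (q, c)}"
  let ?O = "adjacent_avoiding (surface_on V P) B"
  have rho: "\<exists>j x' z'. hinge P (i, x, z) (j, x', z') \<and> \<rho> (i, x, y, z) = (j, x', z', y) \<and> (j, x', z', y) \<in> I"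
    if "(i, x, y, z) \<in> I" for i x y z
  proof -
    have I: "i \<in> V" "exposed P i x" "i \<in> X" "perp x y" "perp x z" "perp y z"
      "pos P i + pos P i + x + y + z = v" "det3 x y z = det3 a (- b) e" using that by (auto simp: I_def)
    obtain j x' z' where h: "hinge P (i, x, z) (j, x', z')"
      using hinge_total[OF T I(1,2,5)] by (metis prod_cases3)
    have e: "edge P (i, x, z) + y = v" using I(7) by (simp add: edge_def algebra_simps)
    have "j \<in> X"
      using hinge_stays_in[OF h ab ae be X(3), where z = y] I e perp_sym[OF I(6)] by (simp add: v_def)
    moreover have "pos P j + pos P j + x' + z' + y = v"
      using hinge_edge[OF h] e by (simp add: edge_def)
    moreover have "det3 x' z' y = det3 a (- b) e"
      using hinge_det3[OF h, of y] det3_swap(2)[of x y z] I(8) by simp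
    moreover have "j \<in> V" "exposed P j x'" "perp x' z'" "perp x' y" "perp z' y"
      using hinge_mem[OF h V(3)] hinge_exposed[OF h] hinge_perp[OF h I(5)]
        hinge_perp3[OF h I(5)] hinge_turned[OF h] I(1,4) perp_sym[OF I(6)]
        turned_perp3[OF hinge_turned[OF h] I(4) perp_sym[OF I(6)]] by simp_all
    ultimately show ?thesis using h hinge_of_eq[OF V(6) h] by (auto simp: I_def \<rho>_def)
  qed
  \<comment> \<open>Of the four candidates for \<open>y\<close>, \<open>b\<close> and
    \<open>- e\<close> leave a \<open>z\<close> that is not perpendicular to it, and
    \<open>e\<close> has the wrong orientation.\<close>
  have at_f: "fl = (p, a, - b, e)" if fl: "fl \<in> I" "fl = (p, a, y, z)" for fl y z
  proof -
    have yz: "perp a y" "perp a z" "perp y z" "y + z = e - b" "det3 a y z = det3 a (- b) e"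
      using fl by (auto simp: I_def v_def algebra_simps)
    have D: "det3 a (- b) e \<noteq> 0" using det3_nonzero ab ae be by simp
    have y: "y = b \<or> y = - b \<or> y = e \<or> y = - e"
      using frame_cases[OF ab ae be perp_dirs(2)[OF yz(1)]] perp_neq[OF yz(1)] by auto
    have z: "z = e - b - y" using yz(4) by (simp add: algebra_simps)
    have bb: "dot b b = 1" "dot b e = 0" using perp_dot[OF be] dot_self[OF perp_dirs(2)[OF ab]] by auto
    from y show ?thesis
    proof (elim disjE)
      assume "y = - b" then show ?thesis using fl(2) z by simp
    next
      assume y: "y = e"
      then have "z = - b" using z by simp
      then have "det3 a e (- b) = det3 a (- b) e" using y yz(5) by simp
      then show ?thesis using det3_swap(2)[of a e "- b"] D by simp
    next
      assume y: "y = b"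
      then have "dot b z = - 2" using z bb by simp
      moreover have "dot b z = 0" using y yz(3) perp_dot by simp
      ultimately show ?thesis by simp
    next
      assume y: "y = - e"
      have "z = e - b + e" using z y by simp
      then have "dot e z = 2"
        using perp_dot[OF perp_sym[OF be]] dot_self[OF perp_dirs(2)[OF ae]] by simp
      moreover have "dot e z = 0" using y yz(3) perp_dot[of "- e" z] perp_dot[of e z] by simp
      ultimately show ?thesis by simp
    qed
  qed
  \<comment> \<open>Inside \<open>X\<close>, the square \<open>(q, c)\<close> could only be the face
    \<open>b\<close> of \<open>p\<close>, but \<open>v\<close> lies on the side \<open>- b\<close>
    of that cube.\<close>
  have not_g: "(q, c, y, z) \<notin> I" for y z
  proof
    assume "(q, c, y, z) \<in> I"
    then have I: "q \<in> X" "perp c y" "perp c z" "pos P q + pos P q + c + y + z = v" by (auto simp: I_def)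
    then have [simp]: "q = p" "c = b" using X(2) by auto
    have "b + y + z = a - b + e" using I(4) by (simp add: v_def algebra_simps)
    then have "dot b (b + y + z) = dot b (a - b + e)" by simp
    then show False using perp_dot[OF be] perp_dot[OF perp_sym[OF ab]] dot_self[OF perp_dirs(2)[OF ab]]
        perp_dot[of b y] perp_dot[of b z] I(2,3) by simp
  qed
  let ?x0 = "(p, a, - b, e)"
  have x0: "?x0 \<in> I" using p X(1) ab ae be by (simp add: I_def v_def)
  have in_B: "fl = ?x0" if "fl \<in> I" "(fst fl, fst (snd fl)) \<in> B" for fl
  proof -
    obtain i w y z where fl: "fl = (i, w, y, z)" by (cases fl)
    then have "(i, w) = (p, a)" using that not_g[of y z] by (auto simp: B_def)
    then show ?thesis using at_f[OF that(1)] fl by simp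
  qed
  have rx0: "\<rho> ?x0 = (r, x, y, - b)" "(r, x, y, - b) \<in> I"
    using rho[OF x0] hinge_unique[OF V(6) r] by auto
  have rx: "(r, x) \<notin> B" using in_B[OF rx0(2)] hinge_other_face[OF r ae] by auto
  \<comment> \<open>Flags at the corner whose squares can be reached from the neighbour over
    \<open>e\<close> without entering \<open>B\<close>.\<close>
  define A where "A = {fl \<in> I. ((r, x), (fst fl, fst (snd fl))) \<in> ?O\<^sup>* \<and> (fst fl, fst (snd fl)) \<notin> B}"
  have A0: "\<rho> ?x0 \<in> A" using rx0 rx by (simp add: A_def)
  have inj: "fl = fl'" if I2: "fl \<in> I" "fl' \<in> I" "\<rho> fl = \<rho> fl'" for fl fl'
  proof -
    obtain i w y z i' w' y' z' where [simp]: "fl = (i, w, y, z)" "fl' = (i', w', y', z')"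
      by (cases fl, cases fl')
    obtain t where t: "hinge P (i, w, z) t" "hinge P (i', w', z') t" "y = y'"
      using rho[of i w y z] rho[of i' w' y' z'] I2 by auto
    have "exposed P i w" "exposed P i' w'" using I2 by (auto simp: I_def)
    then have "hinge P t (i, w, z)" "hinge P t (i', w', z')" using hinge_sym[OF V(4)] t by blast+
    then have "(i', w', z') = (i, w, z)" by (rule hinge_unique[OF V(6)])
    then show ?thesis using t(3) by simp
  qed
  have "finite A"
  proof -
    have "A \<subseteq> V \<times> dirs \<times> dirs \<times> dirs" by (auto simp: A_def I_def dest: perp_dirs)
    then show ?thesis using V(1) finite_dirs by (meson finite_SigmaI finite_subset)
  qed
  \<comment> \<open>A rotation that never came back to the start would map \<open>A\<close> into
    itself. Being injective on a finite set, it would be onto, and the start, as the only preimage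
    of \<open>\<rho> ?x0\<close>, would lie in \<open>A\<close>, although its square is in
    \<open>B\<close>.\<close>
  have "\<exists>fl\<in>A. \<rho> fl = ?x0"
  proof (rule ccontr)
    assume no: "\<not> ?thesis"
    have "\<rho> fl \<in> A" if fl: "fl \<in> A" for fl
    proof -
      obtain i w y z where [simp]: "fl = (i, w, y, z)" by (cases fl)
      have I: "(i, w, y, z) \<in> I" "(i, w) \<notin> B" "((r, x), (i, w)) \<in> ?O\<^sup>*"
        using fl by (auto simp: A_def)
      obtain j x' z' where h: "hinge P (i, w, z) (j, x', z')" "\<rho> fl = (j, x', z', y)" "(j, x', z', y) \<in> I"
        using rho[OF I(1)] by auto
      have nB: "(j, x') \<notin> B" using in_B[OF h(3)] no fl h(2) by auto
      have "i \<in> V" "exposed P i w" "perp w z" using I(1) by (auto simp: I_def)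
      then have "((i, w), (j, x')) \<in> ?O"
        using adjacent_onI[OF V(3) _ _ _ h(1)] nB I(2) by (simp add: adjacent_avoiding_def)
      then show ?thesis using h nB I(3) by (auto simp: A_def intro: rtrancl_into_rtrancl)
    qed
    then have "\<rho> ` A \<subseteq> A" by blast
    moreover have "inj_on \<rho> A" using inj by (auto simp: inj_on_def A_def)
    ultimately have "\<rho> ` A = A" using endo_inj_surj[OF \<open>finite A\<close>] by blast
    then have "\<rho> ?x0 \<in> \<rho> ` A" using A0 by (rule ssubst)
    then obtain fl where fl: "\<rho> ?x0 = \<rho> fl" "fl \<in> A" by (rule imageE)
    then have "fl \<in> I" by (simp add: A_def)
    then have "?x0 \<in> A" using inj[OF x0 _ fl(1)] fl(2) by simp
    then show False by (simp add: A_def B_def)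
  qed
  \<comment> \<open>The flag just before the start crosses into \<open>(p, a)\<close> over the side
    \<open>- b\<close>, so its square is the neighbour there.\<close>
  then obtain fl where fl: "fl \<in> A" "\<rho> fl = ?x0" by blast
  obtain i w y1 z where [simp]: "fl = (i, w, y1, z)" by (cases fl)
  have I: "(i, w, y1, z) \<in> I" "(i, w) \<notin> B" "((r, x), (i, w)) \<in> ?O\<^sup>*"
    using fl by (auto simp: A_def)
  obtain j t z' where "hinge P (i, w, z) (j, t, z')" "\<rho> (i, w, y1, z) = (j, t, z', y1)"
    using rho[OF I(1)] by blast
  then have "hinge P (i, w, z) (p, a, - b)" using fl(2) by simp
  moreover have "exposed P i w" using I(1) by (simp add: I_def)
  ultimately have "hinge P (p, a, - b) (i, w, z)" using hinge_sym[OF V(4)] by simp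
  then have "(i, w, z) = (r', x', y')" by (rule hinge_unique[OF V(6) r'])
  then show "((r, x), (r', x')) \<in> ?O\<^sup>*" "(r', x') \<notin> {(p, a), (q, c)}"
    using I by (auto simp: B_def)
qed
section \<open>Moving a leaf over an edge\<close>

text \<open>Through \<open>\<phi>\<close> both surfaces live on the squares of \<open>S1\<close>.
  The cut keeps the gluings that they have in common, and the gluing step completes them to those of
  \<open>S2\<close>. The common part inherits the manifold conditions except connectedness, which is
  therefore assumed.\<close>

lemma refolding_by_map:
  assumes S1: "grid_manifold S1" and S2: "grid_manifold S2"
    and bij: "bij_betw \<phi> (flags S1) (flags S2)"
    and com: "\<And>x. x \<in> flags S1 \<Longrightarrow> \<phi> (other_end x) = other_end (\<phi> x)"
      "\<And>x. x \<in> flags S1 \<Longrightarrow> \<phi> (other_side x) = other_side (\<phi> x)"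
    and conn: "surface_connected \<lparr>squares = squares S1,
      gluing = {(x, y) \<in> gluing S1. (\<phi> x, \<phi> y) \<in> gluing S2}\<rparr>" (is "surface_connected ?S")
  shows "\<exists>S T. grid_cutting S1 S \<and> grid_gluing S T \<and> isometric T S2"
proof -
  define T where "T = \<lparr>squares = squares S1,
    gluing = {(x, y). x \<in> flags S1 \<and> y \<in> flags S1 \<and> (\<phi> x, \<phi> y) \<in> gluing S2}\<rparr>"
  have fl: "flags ?S = flags S1" "flags T = flags S1" by (simp_all add: flags_def T_def)
  have oe: "other_end x \<in> flags S1" if "x \<in> flags S1" for x
  proof -
    obtain i a b e where "x = (i, a, b, e)" by (cases x)
    then show ?thesis using that by (simp add: flags_def)
  qed
  note inj = bij_betw_imp_inj_on[OF bij]
  have g1: "gluing S1 \<subseteq> flags S1 \<times> flags S1" "sym (gluing S1)" "single_valued (gluing S1)"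
    "\<And>x y. (x, y) \<in> gluing S1 \<Longrightarrow> (other_end x, other_end y) \<in> gluing S1 \<and> y \<noteq> x \<and> y \<noteq> other_end x"
    using S1 unfolding grid_manifold_def by blast+
  have g2: "sym (gluing S2)" "single_valued (gluing S2)"
    "\<And>x y. (x, y) \<in> gluing S2 \<Longrightarrow> (other_end x, other_end y) \<in> gluing S2 \<and> y \<noteq> x \<and> y \<noteq> other_end x"
    using S2 unfolding grid_manifold_def by blast+
  have fin: "finite (squares S1)" "\<forall>(i, a) \<in> squares S1. a \<in> dirs"
    using S1 unfolding grid_manifold_def by blast+
  have Tprop: "(other_end x, other_end y) \<in> gluing T \<and> y \<noteq> x \<and> y \<noteq> other_end x" if "(x, y) \<in> gluing T" for x y
  proof -
    have xy: "x \<in> flags S1" "y \<in> flags S1" "(\<phi> x, \<phi> y) \<in> gluing S2" using that by (auto simp: T_def)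
    then show ?thesis using g2(3)[OF xy(3)] oe[OF xy(1)] oe[OF xy(2)] com(1)[OF xy(1)] com(1)[OF xy(2)]
      by (auto simp: T_def)
  qed
  have ST: "gluing ?S \<subseteq> gluing T" "gluing ?S \<subseteq> gluing S1" using g1(1) by (auto simp: T_def)
  have "grid_manifold ?S"
    unfolding grid_manifold_def fl
  proof (intro conjI)
    show "sym (gluing ?S)" unfolding sym_def using symD[OF g1(2)] symD[OF g2(1)] by simp
    show "single_valued (gluing ?S)" using g1(3) ST(2) by (rule single_valued_subset[rotated])
    show "\<forall>(x, y) \<in> gluing ?S. (other_end x, other_end y) \<in> gluing ?S \<and> y \<noteq> x \<and> y \<noteq> other_end x"
    proof (clarify, intro conjI)
      fix x y assume xy: "(x, y) \<in> gluing ?S"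
      then have "(x, y) \<in> gluing T" "(x, y) \<in> gluing S1" using ST by blast+
      then show "(other_end x, other_end y) \<in> gluing ?S" "y \<noteq> x" "y \<noteq> other_end x"
        using Tprop[of x y] g1(4)[of x y] by (simp_all add: T_def)
    qed
  qed (use fin conn g1(1) in auto)
  moreover have "surface_connected T"
    using conn ST(1) unfolding surface_connected_def fl
    by (meson Un_mono order_refl rtrancl_mono subsetD)
  then have "grid_manifold T"
    unfolding grid_manifold_def fl
  proof (intro conjI)
    show "gluing T \<subseteq> flags S1 \<times> flags S1" by (auto simp: T_def)
    show "sym (gluing T)" using symD[OF g2(1)] unfolding sym_def T_def by simp
    show "single_valued (gluing T)"
    proof (rule single_valuedI)
      fix x y z assume "(x, y) \<in> gluing T" "(x, z) \<in> gluing T"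
      then have "\<phi> y = \<phi> z" "y \<in> flags S1" "z \<in> flags S1"
        using single_valuedD[OF g2(2), of "\<phi> x" "\<phi> y" "\<phi> z"] by (simp_all add: T_def)
      then show "y = z" by (rule inj_onD[OF inj])
    qed
    show "\<forall>(x, y) \<in> gluing T. (other_end x, other_end y) \<in> gluing T \<and> y \<noteq> x \<and> y \<noteq> other_end x"
      using Tprop by blast
  qed (use fin in \<open>auto simp: T_def\<close>)
  moreover have "isometric T S2"
    unfolding isometric_def fl using bij com by (intro exI[of _ \<phi>]) (simp add: T_def)
  ultimately show ?thesis
    using S1 ST unfolding grid_cutting_def grid_gluing_def by (intro exI[of _ ?S] exI[of _ T]) (simp add: T_def)
qed

text \<open>Applied to the sides of a square with normal along \<open>y\<close>, this folds it over
  to a square with normal along \<open>x\<close>.\<close>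

definition turn :: "vec \<Rightarrow> vec \<Rightarrow> vec \<Rightarrow> vec" where
  "turn x y z = (if z = x then y else if z = - x then - y else z)"

text \<open>For the directions of a move this is the rotation about the edge that takes
  \<open>a\<close> to \<open>d\<close> and \<open>b\<close> to \<open>c\<close>, and it turns the
  faces of the leaf accordingly.\<close>

definition turn2 :: "vec \<Rightarrow> vec \<Rightarrow> vec \<Rightarrow> vec \<Rightarrow> vec \<Rightarrow> vec" where
  "turn2 a d b c z = (if z = b \<or> z = - b then turn b c z else turn a d z)"

text \<open>The cube l on the face (p, a) covers the strip of squares (l, - b), (l, a), (l, b), (q, c); after the move,
  the strip (p, a), (l, d), (l, c), (l, - d) lies in the same place of the manifold.\<close>

definition move_map :: "nat \<Rightarrow> vec \<Rightarrow> vec \<Rightarrow> nat \<Rightarrow> vec \<Rightarrow> vec \<Rightarrow> nat \<Rightarrow> flag \<Rightarrow> flag" where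
  "move_map p a b q c d l = (\<lambda>(i, x, y, z).
     if i = l then
       if x = - b then (p, a, turn a b y, turn a b z)
       else (l, turn2 a d b c x, turn2 a d b c y, turn2 a d b c z)
     else if (i, x) = (q, c) then (l, - d, turn d c y, turn d c z)
     else (i, x, y, z))"

text \<open>Perpendicularity of directions is inequality up to sign, so it is preserved by a map
  that can be undone on the vectors concerned and respects negation.\<close>

lemma perp_map:
  assumes "perp x y" "f x \<in> dirs" "f y \<in> dirs" "f (- y) = - f y" "g (f x) = x" "g (f y) = y" "g (f (- y)) = - y"
  shows "perp (f x) (f y)"
  using assms unfolding perp_def by metis

text \<open>The leaf \<open>l\<close> moves from \<open>(p, a)\<close> over the side
  \<open>b\<close> to \<open>(q, c)\<close>, whose side \<open>d\<close> is the same edge;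
  \<open>e\<close> is parallel to this edge.\<close>

locale leaf_move =
  fixes u V P p a b q c d e l
  assumes T: "cube_tree u V P" and p: "p \<in> V" "exposed P p a" and l: "l \<notin> V"
    and ab: "perp a b" and ae: "perp a e" and be: "perp b e"
    and g: "hinge P (p, a, b) (q, c, d)"
begin

lemmas V = cube_tree_basic[OF T]

lemma q: "q \<in> V" "exposed P q c"
  using hinge_mem[OF g V(3)] hinge_exposed[OF g] p by simp_all

lemma cd: "perp c d" and ce: "perp c e" and de: "perp d e"
  using hinge_perp[OF g ab] hinge_perp3[OF g ae be] by simp_all

text \<open>The move back is a move of the same kind. Facts about \<open>P2\<close> and about the
  inverse map \<open>\<phi>'\<close> are therefore those about \<open>P1\<close> and
  \<open>\<phi>\<close> in the swapped situation.\<close>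

lemma swapped: "leaf_move u V P q c d p a b e l"
  using T q l cd ce de hinge_sym[OF V(4) p(2) g] by unfold_locales

lemma pq: "(q, c) \<noteq> (p, a)" "p \<noteq> l" "q \<noteq> l"
  using hinge_other_face[OF g ab] p q l by auto

abbreviation "V' \<equiv> insert l V"
abbreviation "P1 \<equiv> attach P p a l"
abbreviation "P2 \<equiv> attach P q c l"
abbreviation "S1 \<equiv> surface_on V' P1"
abbreviation "S2 \<equiv> surface_on V' P2"
abbreviation "\<phi> \<equiv> move_map p a b q c d l"
abbreviation "\<phi>' \<equiv> move_map q c d p a b l"

lemma tree1: "cube_tree u V' P1"
  using T p l perp_dirs(1)[OF ab] by (intro cube_tree.leaf)

lemmas V1 = V(3) p(1) l
lemmas V2 = V(3) q(1) l
lemmas ex1 = exposed_attach[OF V1]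
lemmas ex2 = exposed_attach[OF V2]

lemma neqs:
  "a \<noteq> - a" "b \<noteq> - b" "c \<noteq> - c" "d \<noteq> - d" "e \<noteq> - e"
  "a \<noteq> b" "a \<noteq> - b" "b \<noteq> a" "b \<noteq> - a" "c \<noteq> d" "c \<noteq> - d" "d \<noteq> c" "d \<noteq> - c"
  "a \<noteq> e" "a \<noteq> - e" "e \<noteq> a" "e \<noteq> - a" "b \<noteq> e" "b \<noteq> - e" "e \<noteq> b" "e \<noteq> - b"
  "c \<noteq> e" "c \<noteq> - e" "e \<noteq> c" "e \<noteq> - c" "d \<noteq> e" "d \<noteq> - e" "e \<noteq> d" "e \<noteq> - d"
  "- a \<noteq> a" "- b \<noteq> b" "- c \<noteq> c" "- d \<noteq> d" "- e \<noteq> e"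
  "- a \<noteq> b" "- b \<noteq> a" "- c \<noteq> d" "- d \<noteq> c"
  "- a \<noteq> e" "- e \<noteq> a" "- b \<noteq> e" "- e \<noteq> b" "- c \<noteq> e" "- e \<noteq> c" "- d \<noteq> e" "- e \<noteq> d"
  using perp_neq[OF ab] perp_neq[OF ae] perp_neq[OF be] perp_neq[OF cd] perp_neq[OF ce] perp_neq[OF de]
  by metis+

lemma dirs: "a \<in> dirs" "b \<in> dirs" "c \<in> dirs" "d \<in> dirs" "e \<in> dirs"
  using perp_dirs ab ae cd by blast+

abbreviation "R \<equiv> turn2 a d b c"

lemma R: "R a = d" "R b = c" "R e = e" "R (- a) = - d" "R (- b) = - c" "R (- e) = - e"
  using neqs by (simp_all add: turn2_def turn_def)

lemma R_dirs:
  assumes "x \<in> dirs"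
  shows "R x \<in> dirs" "turn2 c b d a (R x) = x" "R (- x) = - R x"
  using frame_cases[OF ab ae be assms] R leaf_move.R[OF swapped] dirs by auto

lemma R_perp: "perp x y \<Longrightarrow> perp (R x) (R y)"
  using R_dirs[of x] R_dirs[of y] R_dirs[of "- y"] perp_dirs[of x y] perp_map[of x y R "turn2 c b d a"]
  by simp

lemma side_cases: "perp b y \<Longrightarrow> y = a \<or> y = - a \<or> y = e \<or> y = - e"
  using frame_cases[OF ab ae be, of y] perp_dirs[of b y] perp_neq[of b y] by auto

lemma low: "turn a b a = b" "turn a b (- a) = - b" "turn a b e = e" "turn a b (- e) = - e"
  "turn b a b = a" "turn b a (- b) = - a" "turn b a e = e" "turn b a (- e) = - e"
  using neqs by (simp_all add: turn_def)

lemma low_dirs: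
  assumes "perp b y"
  shows "perp a (turn a b y)" "turn b a (turn a b y) = y" "turn a b (- y) = - turn a b y"
  using side_cases[OF assms] low ab ae by auto

lemma low_perp: "perp b x \<Longrightarrow> perp b y \<Longrightarrow> perp x y \<Longrightarrow> perp (turn a b x) (turn a b y)"
  using low_dirs[of x] low_dirs[of y] low_dirs[of "- y"] perp_dirs(2)[of a "turn a b x"]
    perp_dirs(2)[of a "turn a b y"] perp_map[of x y "turn a b" "turn b a"] by simp

lemma high_dirs:
  assumes "perp a y"
  shows "perp b (turn b a y)" "turn a b (turn b a y) = y" "turn b a (- y) = - turn b a y"
proof -
  have "y = b \<or> y = - b \<or> y = e \<or> y = - e"
    using frame_cases[OF ab ae be, of y] perp_dirs[OF assms] perp_neq[OF assms] by auto
  then show "perp b (turn b a y)" "turn a b (turn b a y) = y" "turn b a (- y) = - turn b a y"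
    using low perp_sym[OF ab] be by auto
qed

lemma high_perp: "perp a x \<Longrightarrow> perp a y \<Longrightarrow> perp x y \<Longrightarrow> perp (turn b a x) (turn b a y)"
  using high_dirs[of x] high_dirs[of y] high_dirs[of "- y"] perp_dirs(2)[of b "turn b a x"]
    perp_dirs(2)[of b "turn b a y"] perp_map[of x y "turn b a" "turn a b"] by simp

lemma flags1: "(i, x, y, z) \<in> flags S1 \<longleftrightarrow> perp x y \<and> perp x z \<and> perp y z \<and>
    (if i = l then x \<noteq> - a else i \<in> V \<and> exposed P i x \<and> (i, x) \<noteq> (p, a))"
  by (auto simp: flags_on ex1)

lemma move_flags:
  assumes "fl \<in> flags S1"
  shows "\<phi> fl \<in> flags S2" "\<phi>' (\<phi> fl) = fl"
    "\<phi> (other_end fl) = other_end (\<phi> fl)" "\<phi> (other_side fl) = other_side (\<phi> fl)"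
proof -
  obtain i x y z where fl: "fl = (i, x, y, z)" by (cases fl)
  have xyz: "perp x y" "perp x z" "perp y z"
    "if i = l then x \<noteq> - a else i \<in> V \<and> exposed P i x \<and> (i, x) \<noteq> (p, a)"
    using assms by (auto simp: fl flags1)
  note d = perp_dirs(1)[OF xyz(1)] perp_dirs(2)[OF xyz(1)] perp_dirs(2)[OF xyz(2)]
  note flags2 = leaf_move.flags1[OF swapped]
  note high_dirs = leaf_move.high_dirs[OF swapped]
  note high_perp = leaf_move.high_perp[OF swapped]
  \<comment> \<open>The first square of the strip leaves the leaf, the other squares of the leaf
    stay on it, the last square \<open>(q, c)\<close> of the strip becomes part of it, and all else
    is fixed.\<close>
  consider "i = l" "x = - b" | "i = l" "x \<noteq> - b" | "i \<noteq> l" "(i, x) = (q, c)" | "i \<noteq> l" "(i, x) \<noteq> (q, c)"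
    by blast
  then have "\<phi> fl \<in> flags S2 \<and> \<phi>' (\<phi> fl) = fl \<and>
    \<phi> (other_end fl) = other_end (\<phi> fl) \<and> \<phi> (other_side fl) = other_side (\<phi> fl)"
  proof cases
    case 1
    have b: "perp b y" "perp b z" using xyz(1,2) 1 by simp_all
    have \<phi>: "\<phi> fl = (p, a, turn a b y, turn a b z)" using 1 by (simp add: fl move_map_def)
    then show ?thesis
      using 1 p pq low_dirs[OF b(1)] low_dirs[OF b(2)] low_perp[OF b xyz(3)]
      by (auto simp: flags2 move_map_def fl)
  next
    case 2
    have \<phi>: "\<phi> fl = (l, R x, R y, R z)" using 2 by (simp add: fl move_map_def)
    have "R x \<noteq> - c" using R_dirs(2)[OF d(1)] leaf_move.R[OF swapped] 2 by auto
    moreover have "R x \<noteq> - d" using R_dirs(2)[OF d(1)] leaf_move.R[OF swapped] 2 xyz(4) by auto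
    ultimately show ?thesis
      using 2 R_dirs[OF d(1)] R_dirs[OF d(2)] R_dirs[OF d(3)] R_perp xyz
      by (auto simp: flags2 move_map_def fl)
  next
    case 3
    have b: "perp d (turn d c y)" "perp d (turn d c z)" "turn c d (turn d c y) = y" "turn c d (turn d c z) = z"
      "turn d c (- z) = - turn d c z" "perp (turn d c y) (turn d c z)"
      using 3 high_dirs[of y] high_dirs[of z] high_perp[of y z] xyz by auto
    then show ?thesis using 3 pq neqs by (auto simp: flags2 move_map_def fl)
  next
    case 4
    then show ?thesis using xyz by (auto simp: flags2 move_map_def fl)
  qed
  then show "\<phi> fl \<in> flags S2" "\<phi>' (\<phi> fl) = fl"
    "\<phi> (other_end fl) = other_end (\<phi> fl)" "\<phi> (other_side fl) = other_side (\<phi> fl)" by blast+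
qed

lemma move_bij: "bij_betw \<phi> (flags S1) (flags S2)"
  by (rule bij_betw_byWitness[where f' = \<phi>'])
    (use move_flags leaf_move.move_flags[OF swapped] in auto)

section \<open>Connectedness of the surface after the cut\<close>

abbreviation "S \<equiv> \<lparr>squares = squares S1, gluing = {(x, y) \<in> gluing S1. (\<phi> x, \<phi> y) \<in> gluing S2}\<rparr>"
abbreviation "B \<equiv> {(p, a), (q, c)}"

lemma tree2: "cube_tree u V' P2"
  using leaf_move.tree1[OF swapped] .

lemmas gl1 = gluing_on[OF cube_tree_basic(3)[OF tree1]]
lemmas gl2 = gluing_on[OF cube_tree_basic(3)[OF tree2]]

lemma sym_S: "sym (gluing S)"
  unfolding sym_def using symD[OF sym_gluing_on[OF tree1]] symD[OF sym_gluing_on[OF tree2]] by simp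

lemma sym_adjacent_S: "sym ((adjacent S)\<^sup>*)"
  by (rule sym_rtrancl[OF sym_adjacent[OF sym_S]])

lemma map_other: "i \<noteq> l \<Longrightarrow> (i, x) \<noteq> (q, c) \<Longrightarrow> \<phi> (i, x, y, z) = (i, x, y, z)"
  by (auto simp: move_map_def)

text \<open>Away from \<open>(p, a)\<close> and \<open>(q, c)\<close> neither place of the leaf
  affects the walk, and \<open>\<phi>\<close> is the identity.\<close>

lemma outside_adjacent:
  assumes "(f, h) \<in> adjacent_avoiding (surface_on V P) B"
  shows "(f, h) \<in> adjacent S"
proof -
  obtain i x j y where [simp]: "f = (i, x)" "h = (j, y)" by (cases f, cases h)
  have n: "(i, x) \<noteq> (p, a)" "(i, x) \<noteq> (q, c)" "(j, y) \<noteq> (p, a)" "(j, y) \<noteq> (q, c)"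
    and adj: "((i, x), (j, y)) \<in> adjacent (surface_on V P)"
    using assms by (auto simp: adjacent_avoiding_def)
  obtain v w where h: "i \<in> V" "exposed P i x" "perp x v" "hinge P (i, x, v) (j, y, w)"
    using adj by (auto simp: adjacent_on[OF V(3)])
  obtain z where z: "perp x z" "perp v z" using ex_perp2[OF h(3)] by blast
  have il: "i \<noteq> l" "j \<noteq> l" using l h(1) hinge_mem[OF h(4) V(3)] by auto
  have "hinge P1 (i, x, v) (j, y, w)" "hinge P2 (i, x, v) (j, y, w)"
    using hinge_attach_other[OF V1 h(4), of a] hinge_attach_other[OF V2 h(4), of c] h(1) n by simp_all
  then have "((i, x, v, z), (j, y, w, z)) \<in> gluing S"
    using h z n il by (simp add: gl1 gl2 ex1 ex2 map_other)
  then show ?thesis by (auto intro: adjacentI)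
qed

lemma outside_reach:
  assumes "(f, h) \<in> (adjacent_avoiding (surface_on V P) B)\<^sup>*"
  shows "(f, h) \<in> (adjacent S)\<^sup>*"
  using assms by (rule rtrancl_induct) (auto dest: outside_adjacent intro: rtrancl_into_rtrancl)

text \<open>One end of the strip: this neighbour meets the wall \<open>(l, - b)\<close> before the
  move and the uncovered \<open>(p, a)\<close> after it, and \<open>\<phi>\<close> takes the one to
  the other.\<close>

lemma low_adjacent:
  assumes "hinge P (p, a, - b) (r, x, y)" "(r, x) \<notin> B"
  shows "((l, - b), (r, x)) \<in> adjacent S"
proof -
  have rl: "r \<noteq> l" using hinge_mem[OF assms(1) V(3)] p l by auto
  have h: "hinge P1 (p, a, - b) (r, x, y)" "hinge P2 (p, a, - b) (r, x, y)"
    using hinge_attach_other[OF V1 assms(1), of a] hinge_attach_other[OF V2 assms(1), of c] p assms(2) by simp_all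
  have "((l, - b, - a, e), (r, x, y, e)) \<in> gluing S1"
    using hinge_attach_wall[OF V1 h(1)] neqs ab ae be perp_sym[OF ab] by (simp add: gl1 ex1)
  moreover have "((p, a, - b, e), (r, x, y, e)) \<in> gluing S2"
    using h(2) pq ab ae be p by (auto simp: gl2 ex2)
  moreover have "\<phi> (l, - b, - a, e) = (p, a, - b, e)" using low by (simp add: move_map_def)
  moreover have "\<phi> (r, x, y, e) = (r, x, y, e)" using rl assms(2) by (intro map_other) auto
  ultimately have "((l, - b, - a, e), (r, x, y, e)) \<in> gluing S" by simp
  then show ?thesis by (rule adjacentI)
qed

text \<open>The other end of the strip, where \<open>(q, c)\<close> corresponds to the wall
  \<open>(l, - d)\<close> after the move.\<close>

lemma high_adjacent:
  assumes "hinge P (q, c, - d) (r, x, y)" "(r, x) \<notin> B"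
  shows "((q, c), (r, x)) \<in> adjacent S"
proof -
  have rl: "r \<noteq> l" using hinge_mem[OF assms(1) V(3)] q l by auto
  have h: "hinge P1 (q, c, - d) (r, x, y)" "hinge P2 (q, c, - d) (r, x, y)"
    using hinge_attach_other[OF V1 assms(1), of a] hinge_attach_other[OF V2 assms(1), of c] q assms(2) by simp_all
  have "((q, c, - d, e), (r, x, y, e)) \<in> gluing S1"
    using h(1) pq cd ce de q by (auto simp: gl1 ex1)
  moreover have "((l, - d, - c, e), (r, x, y, e)) \<in> gluing S2"
    using hinge_attach_wall[OF V2 h(2)] neqs ce de perp_sym[OF cd] by (simp add: gl2 ex2)
  moreover have "\<phi> (q, c, - d, e) = (l, - d, - c, e)"
    using pq neqs by (simp add: move_map_def turn_def)
  moreover have "\<phi> (r, x, y, e) = (r, x, y, e)" using rl assms(2) by (intro map_other) auto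
  ultimately have "((q, c, - d, e), (r, x, y, e)) \<in> gluing S" by simp
  then show ?thesis by (rule adjacentI)
qed

text \<open>The strip shifts as a whole, so the gluings inside it persist. The walls
  \<open>e\<close> and \<open>- e\<close> stay glued to \<open>(l, a)\<close>, which becomes
  \<open>(l, d)\<close>.\<close>

lemma leaf_adjacent:
  "((l, - b), (l, a)) \<in> adjacent S" "((l, b), (l, a)) \<in> adjacent S" "((q, c), (l, b)) \<in> adjacent S"
  "((l, e), (l, a)) \<in> adjacent S" "((l, - e), (l, a)) \<in> adjacent S"
proof -
  have g': "hinge P (q, c, d) (p, a, b)" using leaf_move.g[OF swapped] .
  note leaf1 = hinge_attach_leaf[OF V1] and leaf2 = hinge_attach_leaf[OF V2]
  have "hinge P2 (p, a, b) (l, d, - c)" using hinge_attach_face[OF V2 g _ _ refl] p ab by simp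
  then have "((p, a, b, e), (l, d, - c, e)) \<in> gluing S2"
    using p pq ab ae be by (auto simp: gl2 ex2)
  moreover have "((l, - b, a, e), (l, a, - b, e)) \<in> gluing S1"
    using leaf1[of a a "- b"] neqs ae be perp_sym[OF ab] by (simp add: gl1 ex1)
  moreover have "\<phi> (l, - b, a, e) = (p, a, b, e)" "\<phi> (l, a, - b, e) = (l, d, - c, e)"
    using low R neqs by (simp_all add: move_map_def)
  ultimately have "((l, - b, a, e), (l, a, - b, e)) \<in> gluing S" by simp
  then show "((l, - b), (l, a)) \<in> adjacent S" by (rule adjacentI)

  have "((l, b, a, e), (l, a, b, e)) \<in> gluing S1"
    using leaf1[of a a b] neqs ae be perp_sym[OF ab] by (simp add: gl1 ex1)
  moreover have "((l, c, d, e), (l, d, c, e)) \<in> gluing S2"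
    using leaf2[of d c c] neqs ce de cd by (simp add: gl2 ex2)
  moreover have "\<phi> (l, b, a, e) = (l, c, d, e)" "\<phi> (l, a, b, e) = (l, d, c, e)"
    using R neqs by (simp_all add: move_map_def)
  ultimately have "((l, b, a, e), (l, a, b, e)) \<in> gluing S" by simp
  then show "((l, b), (l, a)) \<in> adjacent S" by (rule adjacentI)

  have "hinge P1 (q, c, d) (l, b, - a)" using hinge_attach_face[OF V1 g' _ _ refl] q cd by simp
  then have "((q, c, d, e), (l, b, - a, e)) \<in> gluing S1"
    using q pq cd ce de by (auto simp: gl1 ex1)
  moreover have "((l, - d, c, e), (l, c, - d, e)) \<in> gluing S2"
    using leaf2[of c c "- d"] neqs ce de perp_sym[OF cd] by (simp add: gl2 ex2)
  moreover have "\<phi> (q, c, d, e) = (l, - d, c, e)" "\<phi> (l, b, - a, e) = (l, c, - d, e)"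
    using R neqs pq by (simp_all add: move_map_def turn_def)
  ultimately have "((q, c, d, e), (l, b, - a, e)) \<in> gluing S" by simp
  then show "((q, c), (l, b)) \<in> adjacent S" by (rule adjacentI)

  have side: "((l, f), (l, a)) \<in> adjacent S" if f: "f = e \<or> f = - e" for f
  proof -
    have n: "perp a f" "perp b f" "perp c f" "perp d f" "f \<noteq> - a" "f \<noteq> - c" "f \<noteq> - b"
      using f ae be ce de neqs by auto
    have "((l, f, a, b), (l, a, f, b)) \<in> gluing S1"
      using leaf1[of a a f] neqs n ab perp_sym[OF n(1)] perp_sym[OF n(2)] by (simp add: gl1 ex1)
    moreover have "((l, f, d, c), (l, d, f, c)) \<in> gluing S2"
      using leaf2[of d c f] neqs n cd perp_sym[OF n(3)] perp_sym[OF n(4)] perp_sym[OF cd]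
      by (simp add: gl2 ex2)
    moreover have "R f = f" using R f by auto
    then have "\<phi> (l, f, a, b) = (l, f, d, c)" "\<phi> (l, a, f, b) = (l, d, f, c)"
      using R neqs n by (simp_all add: move_map_def)
    ultimately have "((l, f, a, b), (l, a, f, b)) \<in> gluing S" by simp
    then show ?thesis by (rule adjacentI)
  qed
  then show "((l, e), (l, a)) \<in> adjacent S" "((l, - e), (l, a)) \<in> adjacent S" by simp_all
qed

text \<open>A neighbour over \<open>e\<close> or \<open>- e\<close> may lose its contact with the
  leaf. Turning about a corner of \<open>(p, a)\<close> leads from it to the neighbour over
  \<open>- b\<close>, which keeps its contact by \<open>low_adjacent\<close>.\<close>

lemma via_low:
  assumes h: "hinge P (p, a, w) (i, x, y)" "perp a w" "(i, x) \<notin> B"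
  shows "((i, x), (l, - b)) \<in> (adjacent S)\<^sup>*"
proof -
  have turn: ?thesis if w: "perp b w"
  proof -
    obtain r' x' y' where r': "hinge P (p, a, - b) (r', x', y')"
      using hinge_total[OF T p, of "- b"] ab by (auto intro: that)
    note C = corner[OF T p ab h(2) w g h(1) r']
    have "((r', x'), (l, - b)) \<in> (adjacent S)\<^sup>*"
      using symD[OF sym_adjacent_S r_into_rtrancl[OF low_adjacent[OF r' C(2)]]] .
    then show ?thesis using outside_reach[OF C(1)] by (rule rtrancl_trans[rotated])
  qed
  have "w = b \<or> w = - b \<or> w = e \<or> w = - e"
    using frame_cases[OF ab ae be, of w] perp_dirs[OF h(2)] perp_neq[OF h(2)] by auto
  then show ?thesis
  proof (elim disjE)
    assume "w = b"
    then have "(i, x) = (q, c)" using hinge_unique[OF V(6) g, of "(i, x, y)"] h(1) by simp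
    then show ?thesis using h(3) by simp
  next
    assume "w = - b"
    then show ?thesis using symD[OF sym_adjacent_S r_into_rtrancl[OF low_adjacent[of i x y]]] h by simp
  qed (use turn be in auto)
qed

lemma via_high:
  assumes h: "hinge P (q, c, w) (i, x, y)" "perp c w" "(i, x) \<notin> B"
  shows "((i, x), (q, c)) \<in> (adjacent S)\<^sup>*"
proof -
  have turn: ?thesis if w: "perp d w"
  proof -
    obtain r' x' y' where r': "hinge P (q, c, - d) (r', x', y')"
      using hinge_total[OF T q, of "- d"] cd by (auto intro: that)
    note C = corner[OF T q cd h(2) w leaf_move.g[OF swapped] h(1) r']
    have "((r', x'), (q, c)) \<in> (adjacent S)\<^sup>*"
      using symD[OF sym_adjacent_S r_into_rtrancl[OF high_adjacent[OF r']]] C(2) by auto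
    then show ?thesis using outside_reach[of "(i, x)" "(r', x')"] C(1)
      by (simp add: insert_commute rtrancl_trans)
  qed
  have "w = d \<or> w = - d \<or> w = e \<or> w = - e"
    using frame_cases[OF cd ce de, of w] perp_dirs[OF h(2)] perp_neq[OF h(2)] by auto
  then show ?thesis
  proof (elim disjE)
    assume "w = d"
    then have "(i, x) = (p, a)" using hinge_unique[OF V(6) leaf_move.g[OF swapped], of "(i, x, y)"] h(1) by simp
    then show ?thesis using h(3) by simp
  next
    assume "w = - d"
    then show ?thesis using symD[OF sym_adjacent_S r_into_rtrancl[OF high_adjacent[of i x y]]] h by simp
  qed (use turn de in auto)
qed

text \<open>A path in the surface without the leaf is followed up to its first entry into
  \<open>B\<close>; \<open>via_low\<close> or \<open>via_high\<close> replaces that entry.\<close>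

lemma reach_leaf:
  assumes "(f, (p, a)) \<in> (adjacent (surface_on V P))\<^sup>*"
  shows "f \<notin> B \<longrightarrow> (f, (l, a)) \<in> (adjacent S)\<^sup>*"
  using assms
proof (induction rule: converse_rtrancl_induct)
  case base
  then show ?case by simp
next
  case (step f h)
  have la: "((l, - b), (l, a)) \<in> (adjacent S)\<^sup>*" "((q, c), (l, a)) \<in> (adjacent S)\<^sup>*"
    using leaf_adjacent by (auto intro: converse_rtrancl_into_rtrancl)
  obtain i x j y where [simp]: "f = (i, x)" "h = (j, y)" by (cases f, cases h)
  obtain v w where h: "i \<in> V" "exposed P i x" "perp x v" "hinge P (i, x, v) (j, y, w)"
    using step.hyps(1) by (auto simp: adjacent_on[OF V(3)])
  have h': "hinge P (j, y, w) (i, x, v)" "perp y w"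
    using hinge_sym[OF V(4) h(2,4)] hinge_perp[OF h(4,3)] by simp_all
  show ?case
  proof (intro impI)
    assume f: "f \<notin> B"
    consider "h \<notin> B" | "h = (p, a)" | "h = (q, c)" by auto
    then show "(f, (l, a)) \<in> (adjacent S)\<^sup>*"
    proof cases
      case 1
      then have "(f, h) \<in> adjacent S"
        using outside_adjacent step.hyps(1) f by (simp add: adjacent_avoiding_def)
      then show ?thesis using step.IH 1 by (simp add: converse_rtrancl_into_rtrancl)
    next
      case 2
      then have "(f, (l, - b)) \<in> (adjacent S)\<^sup>*" using via_low[of w i x v] h' f by simp
      then show ?thesis using la(1) by (rule rtrancl_trans)
    next
      case 3
      then have "(f, (q, c)) \<in> (adjacent S)\<^sup>*" using via_high[of w i x v] h' f by simp
      then show ?thesis using la(2) by (rule rtrancl_trans)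
    qed
  qed
qed

lemma connected_S: "surface_connected S"
proof (rule surface_connectedI)
  show "(l, a) \<in> squares S" using dirs neqs by (simp add: squares_on ex1)
  show "perp a b" by (rule ab)
  show "sym (gluing S)" by (rule sym_S)
  have "flags S = flags S1" by (simp add: flags_def)
  moreover have "gluing S1 \<subseteq> flags S1 \<times> flags S1"
    using grid_manifold_on[OF tree1] by (simp add: grid_manifold_def)
  ultimately show "gluing S \<subseteq> flags S \<times> flags S" by auto
  show "((i, x), (l, a)) \<in> (adjacent S)\<^sup>*" if "(i, x) \<in> squares S" for i x
  proof (cases "i = l")
    case True
    then have "x = a \<or> x = b \<or> x = - b \<or> x = e \<or> x = - e"
      using that frame_cases[OF ab ae be, of x] by (auto simp: squares_on ex1)
    then show ?thesis using True leaf_adjacent by auto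
  next
    case False
    then have ix: "(i, x) \<in> squares (surface_on V P)" "(i, x) \<noteq> (p, a)"
      using that by (auto simp: squares_on ex1)
    show ?thesis
    proof (cases "(i, x) = (q, c)")
      case True
      then show ?thesis using leaf_adjacent by (auto intro: converse_rtrancl_into_rtrancl)
    next
      case False
      have "(p, a) \<in> squares (surface_on V P)" using p dirs by (simp add: squares_on)
      then show ?thesis using reach_leaf[OF adjacent_connected[OF T ix(1)]] ix(2) False by simp
    qed
  qed
qed

lemma refolding:
  "\<exists>S T. grid_cutting S1 S \<and> grid_gluing S T \<and> isometric T S2"
  by (rule refolding_by_map[OF grid_manifold_on[OF tree1] grid_manifold_on[OF tree2] move_bij move_flags(3,4) connected_S])

end

section \<open>Graph trees and cube trees\<close>

text \<open>The last vertex of a longest path from \<open>r\<close> is a leaf: a further neighbour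
  would either prolong the path or close a cycle.\<close>

lemma graph_tree_leaf:
  assumes E: "graph_tree V E" and r: "r \<in> V" "V \<noteq> {r}"
  obtains l p where "l \<in> V" "l \<noteq> r" "(l, p) \<in> E" "\<And>x. (l, x) \<in> E \<Longrightarrow> x = p"
proof -
  have G: "finite V" "E \<subseteq> V \<times> V" "sym E" "irrefl E" "\<forall>u\<in>V. \<forall>v\<in>V. (u, v) \<in> E\<^sup>*"
    and acyc: "\<And>vs. \<not> graph_cycle E vs"
    using E by (auto simp: graph_tree_def undirected_graph_def graph_connected_def)
  define path where "path = (\<lambda>vs. vs \<noteq> [] \<and> vs ! 0 = r \<and> distinct vs \<and> set vs \<subseteq> V \<and>
    (\<forall>k. Suc k < length vs \<longrightarrow> (vs ! k, vs ! Suc k) \<in> E))"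
  have len: "path vs \<Longrightarrow> length vs \<le> card V" for vs
    using card_mono[OF G(1), of "set vs"] by (simp add: path_def distinct_card)
  have "path [r]" using r by (simp add: path_def)
  then obtain vs where vs: "path vs" and max: "\<And>ws. path ws \<Longrightarrow> length ws \<le> length vs"
    using ex_has_greatest_nat[of path "[r]" length "Suc (card V)"] len le_imp_less_Suc by metis
  define m where "m = length vs"
  have P: "vs \<noteq> []" "vs ! 0 = r" "distinct vs" "set vs \<subseteq> V" "\<And>k. Suc k < m \<Longrightarrow> (vs ! k, vs ! Suc k) \<in> E"
    using vs by (auto simp: path_def m_def)
  obtain v where "v \<in> V" "v \<noteq> r" using r by blast
  then have "(r, v) \<in> E\<^sup>*" using G(5) r by blast
  then obtain w where w: "(r, w) \<in> E" using \<open>v \<noteq> r\<close> by (metis converse_rtranclE)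
  moreover have "w \<noteq> r" using w G(4) by (auto simp: irrefl_def)
  ultimately have "path [r, w]" using r G(2) by (auto simp: path_def)
  then have m2: "2 \<le> m" using max by (fastforce simp: m_def)
  define l where "l = vs ! (m - 1)"
  have lV: "l \<in> V" using P m2 by (auto simp: l_def m_def)
  have "l \<noteq> r" using P(3) m2 nth_eq_iff_index_eq[OF P(3), of "m - 1" 0] P(1,2) by (auto simp: l_def m_def)
  moreover have lp: "(l, vs ! (m - 2)) \<in> E"
  proof -
    have "Suc (m - 2) = m - 1" using m2 by simp
    then show ?thesis using P(5)[of "m - 2"] m2 symD[OF G(3)] by (simp add: l_def)
  qed
  moreover have "x = vs ! (m - 2)" if x: "(l, x) \<in> E" for x
  proof -
    have "x \<in> V" "x \<noteq> l" using x G(2,4) by (auto simp: irrefl_def)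
    have "x \<in> set vs"
    proof (rule ccontr)
      assume nx: "x \<notin> set vs"
      have "path (vs @ [x])"
        unfolding path_def
      proof (intro conjI allI impI)
        show "(vs @ [x]) ! 0 = r" using P(1,2) by (simp add: nth_append)
        fix k assume k: "Suc k < length (vs @ [x])"
        show "((vs @ [x]) ! k, (vs @ [x]) ! Suc k) \<in> E"
        proof (cases "Suc k < m")
          case True
          then show ?thesis using P(5)[of k] by (simp add: nth_append m_def)
        next
          case False
          then have "Suc k = m" "k = m - 1" using k by (simp_all add: m_def)
          then show ?thesis using x P(1) by (simp add: nth_append m_def l_def)
        qed
      qed (use P nx \<open>x \<in> V\<close> in auto)
      then show False using max[of "vs @ [x]"] by simp
    qed
    then obtain j where j: "j < m" "x = vs ! j" by (auto simp: in_set_conv_nth m_def)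
    have "j \<noteq> m - 1" using j \<open>x \<noteq> l\<close> by (auto simp: l_def)
    have "\<not> j < m - 2"
    proof
      assume jm: "j < m - 2"
      \<comment> \<open>The part of the path from \<open>x\<close> to its end \<open>l\<close>,
        closed by the edge from \<open>l\<close> to \<open>x\<close>.\<close>
      have "graph_cycle E (drop j vs)"
        unfolding graph_cycle_def
      proof (intro conjI allI impI)
        show "3 \<le> length (drop j vs)" using jm by (simp add: m_def)
        show "distinct (drop j vs)" using P(3) by simp
        fix k assume k: "k < length (drop j vs)"
        show "(drop j vs ! k, drop j vs ! (Suc k mod length (drop j vs))) \<in> E"
        proof (cases "Suc k = m - j")
          case True
          then have "j + k = m - 1" "Suc k mod length (drop j vs) = 0" using k by (simp_all add: m_def)
          then show ?thesis using x j by (simp add: l_def m_def)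
        next
          case False
          then have "Suc k < m - j" using k by (simp add: m_def)
          then show ?thesis using P(5)[of "j + k"] j by (simp add: m_def)
        qed
      qed
      then show False using acyc by blast
    qed
    then have "j = m - 2" using j \<open>j \<noteq> m - 1\<close> by linarith
    then show ?thesis using j by simp
  qed
  ultimately show ?thesis using that lV by blast
qed

lemma graph_tree_remove_leaf:
  assumes E: "graph_tree V E" and l: "l \<in> V" "r \<in> V" "l \<noteq> r" "(l, p) \<in> E" "\<And>x. (l, x) \<in> E \<Longrightarrow> x = p"
  shows "graph_tree (V - {l}) (E \<inter> (V - {l}) \<times> (V - {l}))" (is "graph_tree ?V ?E")
proof -
  have G: "finite V" "E \<subseteq> V \<times> V" "sym E" "irrefl E" "\<forall>u\<in>V. \<forall>v\<in>V. (u, v) \<in> E\<^sup>*"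
    and acyc: "\<And>vs. \<not> graph_cycle E vs"
    using E by (auto simp: graph_tree_def undirected_graph_def graph_connected_def)
  have pl: "p \<noteq> l" "p \<in> V" using l(4) G(2,4) by (auto simp: irrefl_def)
  \<comment> \<open>An excursion to \<open>l\<close> leaves and returns through \<open>p\<close>, so
    reading \<open>p\<close> for \<open>l\<close> yields a path that avoids
    \<open>l\<close>.\<close>
  have conn: "(x, if y = l then p else y) \<in> ?E\<^sup>*" if "(x, y) \<in> E\<^sup>*" "x \<in> ?V" for x y
    using that(1)
  proof (induction rule: rtrancl_induct)
    case base
    then show ?case using that(2) by simp
  next
    case (step y z)
    have "(y, z) \<in> ?E \<or> (if y = l then p else y) = (if z = l then p else z)"
    proof (cases "y = l \<or> z = l")
      case True
      then show ?thesis using l(5) step.hyps(2) symD[OF G(3)] pl by metis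
    qed (use step.hyps(2) G(2) in blast)
    then show ?case using step.IH step.hyps(2) by (auto split: if_splits intro: rtrancl_into_rtrancl)
  qed
  have "graph_connected ?V ?E"
    unfolding graph_connected_def
  proof (intro conjI ballI)
    show "?V \<noteq> {}" using l(2,3) by blast
    show "(x, y) \<in> ?E\<^sup>*" if "x \<in> ?V" "y \<in> ?V" for x y
      using conn[of x y] that G(5) by simp
  qed
  moreover have "\<not> graph_cycle ?E vs" for vs
    using acyc[of vs] by (auto simp: graph_cycle_def)
  moreover have "undirected_graph ?V ?E"
    using G by (auto simp: undirected_graph_def sym_def irrefl_def)
  ultimately show ?thesis by (simp add: graph_tree_def)
qed

text \<open>Leaves other than \<open>r\<close> are removed until \<open>r\<close> alone is left;
  hence any cube can serve as the root.\<close>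

lemma cube_tree_of_graph_tree:
  assumes "graph_tree V (joins P)" "\<forall>(i, j) \<in> joins P. share_face (pos P i) (pos P j)" "face_simple P" "r \<in> V"
  shows "cube_tree r V P"
  using assms
proof (induction "card V" arbitrary: V P rule: less_induct)
  case less
  have G: "finite V" "joins P \<subseteq> V \<times> V" "sym (joins P)" "irrefl (joins P)"
    using less.prems(1) by (auto simp: graph_tree_def undirected_graph_def)
  show ?case
  proof (cases "V = {r}")
    case True
    then have "joins P = {}" using G(2,4) by (auto simp: irrefl_def)
    then show ?thesis using True by (simp add: cube_tree.root)
  next
    case False
    obtain l p where l: "l \<in> V" "l \<noteq> r" "(l, p) \<in> joins P" "\<And>x. (l, x) \<in> joins P \<Longrightarrow> x = p"
      using graph_tree_leaf[OF less.prems(1,4) False] by blast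
    define Q where "Q = P\<lparr>joins := joins P \<inter> (V - {l}) \<times> (V - {l})\<rparr>"
    define a where "a = pos P l - pos P p"
    have pl: "p \<noteq> l" "p \<in> V" "(p, l) \<in> joins P" using l(3) G(2,4) symD[OF G(3)] by (auto simp: irrefl_def)
    have sub: "joined Q i x j \<Longrightarrow> joined P i x j" for i x j by (auto simp: Q_def joined_def)
    have "joins P = joins Q \<union> {(p, l), (l, p)}"
    proof
      show "joins P \<subseteq> joins Q \<union> {(p, l), (l, p)}"
      proof (rule subrelI)
        fix x y assume xy: "(x, y) \<in> joins P"
        then have "x = l \<Longrightarrow> y = p" "y = l \<Longrightarrow> x = p" using l(4) symD[OF G(3)] by blast+
        then show "(x, y) \<in> joins Q \<union> {(p, l), (l, p)}" using xy G(2) by (auto simp: Q_def)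
      qed
    qed (use pl(3) l(3) in \<open>auto simp: Q_def\<close>)
    then have "joins P = joins (attach Q p a l)" unfolding joins_attach .
    moreover have "pos Q p + a = pos P l" "pos Q = pos P" by (simp_all add: a_def Q_def)
    then have "pos P = pos (attach Q p a l)" unfolding pos_attach by (metis fun_upd_triv)
    ultimately have PQ: "P = attach Q p a l" by (intro polycube.equality) simp_all
    have "cube_tree r (V - {l}) Q"
    proof (rule less.hyps)
      show "card (V - {l}) < card V" using G(1) l(1) by (rule card_Diff1_less)
      show "graph_tree (V - {l}) (joins Q)"
        using graph_tree_remove_leaf[OF less.prems(1) l(1) less.prems(4) l(2,3,4)] by (simp add: Q_def)
      show "\<forall>(i, j) \<in> joins Q. share_face (pos Q i) (pos Q j)" using less.prems(2) by (auto simp: Q_def)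
      show "face_simple Q" using less.prems(3) sub unfolding face_simple_def by blast
      show "r \<in> V - {l}" using less.prems(4) l(2) by simp
    qed
    moreover have "a \<in> dirs" using less.prems(2) pl(3) by (auto simp: a_def share_face_def)
    moreover have "exposed Q p a"
      unfolding exposed_def
    proof
      assume "\<exists>j. joined Q p a j"
      then obtain j where j: "joined Q p a j" ..
      have "joined P p a l" using pl(3) by (simp add: joined_def a_def)
      then have "j = l" using less.prems(3) sub[OF j] unfolding face_simple_def by blast
      then show False using j by (simp add: joined_def Q_def)
    qed
    moreover have "insert l (V - {l}) = V" using l(1) by blast
    ultimately show ?thesis using cube_tree.leaf[of r "V - {l}" Q p l a] pl PQ by simp
  qed
qed

text \<open>A cycle through the new leaf would have \<open>p\<close> on both sides of
  \<open>l\<close>, which a length of at least three forbids.\<close>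

lemma graph_tree_of_cube_tree: "cube_tree u V P \<Longrightarrow> graph_tree V (joins P)"
proof (induction rule: cube_tree.induct)
  case (root P)
  have "\<not> graph_cycle {} vs" for vs :: "nat list"
    by (cases vs) (auto simp: graph_cycle_def)
  with root show ?case
    by (simp add: graph_tree_def undirected_graph_def graph_connected_def sym_def irrefl_def)
next
  case (leaf V P p l a)
  let ?E = "joins (attach P p a l)"
  have T: "cube_tree u (insert l V) (attach P p a l)" using leaf.hyps by (intro cube_tree.leaf)
  have G: "finite V" "joins P \<subseteq> V \<times> V" "\<forall>u\<in>V. \<forall>v\<in>V. (u, v) \<in> (joins P)\<^sup>*"
    and acyc: "\<And>vs. \<not> graph_cycle (joins P) vs"
    using leaf.IH by (auto simp: graph_tree_def undirected_graph_def graph_connected_def)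
  have mono: "(joins P)\<^sup>* \<subseteq> ?E\<^sup>*" by (intro rtrancl_mono) (auto simp: joins_attach)
  have lp: "(l, p) \<in> ?E" "(p, l) \<in> ?E" by (simp_all add: joins_attach)
  have top: "(x, p) \<in> ?E\<^sup>* \<and> (p, x) \<in> ?E\<^sup>*" if "x \<in> insert l V" for x
    using that mono G(3) leaf.hyps(2) lp by (cases "x = l") auto
  then have "graph_connected (insert l V) ?E"
    unfolding graph_connected_def by (meson insert_not_empty rtrancl_trans)
  moreover have "undirected_graph (insert l V) ?E"
    using cube_tree_basic[OF T] by (simp add: undirected_graph_def)
  moreover have "\<not> graph_cycle ?E vs" for vs
  proof
    assume C: "graph_cycle ?E vs"
    define m where "m = length vs"
    have c: "3 \<le> m" "distinct vs" "\<And>k. k < m \<Longrightarrow> (vs ! k, vs ! (Suc k mod m)) \<in> ?E"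
      using C by (auto simp: graph_cycle_def m_def)
    have lE: "(l, x) \<in> ?E \<Longrightarrow> x = p" "(x, l) \<in> ?E \<Longrightarrow> x = p" for x
      using G(2) leaf.hyps(3) by (auto simp: joins_attach)
    show False
    proof (cases "l \<in> set vs")
      case True
      then obtain k where k: "k < m" "vs ! k = l" by (auto simp: in_set_conv_nth m_def)
      \<comment> \<open>The cyclic predecessor of \<open>k\<close>.\<close>
      define k1 where "k1 = (if k = 0 then m - 1 else k - 1)"
      have k1: "k1 < m" "Suc k1 mod m = k" "k1 \<noteq> Suc k mod m"
        using k c(1) by (auto simp: k1_def mod_Suc)
      have k2: "Suc k mod m < m" using k(1) by (intro mod_less_divisor) linarith
      have "vs ! (Suc k mod m) = p" using lE(1) c(3)[OF k(1)] k(2) by simp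
      moreover have "vs ! k1 = p" using lE(2) c(3)[OF k1(1)] k1(2) k(2) by simp
      ultimately show False
        using nth_eq_iff_index_eq[OF c(2), of k1 "Suc k mod m"] k1 k2 by (simp add: m_def)
    next
      case False
      have "(vs ! k, vs ! (Suc k mod m)) \<in> joins P" if "k < m" for k
      proof -
        have "Suc k mod m < m" using that by (intro mod_less_divisor) linarith
        then have "vs ! k \<noteq> l" "vs ! (Suc k mod m) \<noteq> l"
          using that False nth_mem[of k vs] nth_mem[of "Suc k mod m" vs] by (auto simp: m_def)
        then show ?thesis using c(3)[OF that] by (simp add: joins_attach)
      qed
      then have "graph_cycle (joins P) vs" using c by (simp add: graph_cycle_def m_def)
      then show False using acyc by blast
    qed
  qed
  ultimately show ?case by (simp add: graph_tree_def)
qed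

text \<open>The root \<open>r\<close> is free, so it can be chosen as a cube of largest first
  coordinate.\<close>

lemma tree_shaped_iff: "r < n \<Longrightarrow> tree_shaped n P \<longleftrightarrow> cube_tree r {..<n} P"
  using cube_tree_of_graph_tree[of "{..<n}" P r] graph_tree_of_cube_tree[of r "{..<n}" P]
    cube_tree_basic(6,7)[of r "{..<n}" P]
  unfolding tree_shaped_def face_simple_def by blast

section \<open>Relabelling\<close>

text \<open>Positions enter only through the directions of joins, which is all that the surface
  depends on; translations are therefore invisible.\<close>

definition relabels :: "(nat \<Rightarrow> nat) \<Rightarrow> nat set \<Rightarrow> polycube \<Rightarrow> nat set \<Rightarrow> polycube \<Rightarrow> bool" where
  "relabels \<sigma> V P V' P' \<longleftrightarrow> bij_betw \<sigma> V V' \<and>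
     (\<forall>i\<in>V. \<forall>j\<in>V. \<forall>x. joined P' (\<sigma> i) x (\<sigma> j) \<longleftrightarrow> joined P i x j)"

lemma relabels_attach:
  assumes R: "relabels \<sigma> V P V' P'" and J: "joins P \<subseteq> V \<times> V" "joins P' \<subseteq> V' \<times> V'"
    and p: "p \<in> V" "l \<notin> V" "l' \<notin> V'"
  shows "relabels (\<sigma>(l := l')) (insert l V) (attach P p a l) (insert l' V') (attach P' (\<sigma> p) a l')"
proof -
  have \<sigma>: "bij_betw \<sigma> V V'" and
    jj: "\<And>i j x. i \<in> V \<Longrightarrow> j \<in> V \<Longrightarrow> joined P' (\<sigma> i) x (\<sigma> j) \<longleftrightarrow> joined P i x j"
    using R by (auto simp: relabels_def)
  have m: "\<sigma> i \<in> V'" "\<sigma> i \<noteq> l'" "\<sigma> i = \<sigma> p \<longleftrightarrow> i = p" if "i \<in> V" for i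
    using that \<sigma> p by (auto simp: bij_betw_def inj_on_def)
  have "bij_betw (\<sigma>(l := l')) V V'"
    using \<sigma> p(2) by (subst bij_betw_cong[of V _ \<sigma>]) auto
  then have "bij_betw (\<sigma>(l := l')) (insert l V) (insert l' V')"
    using p(2,3) notIn_Un_bij_betw3[of l V "\<sigma>(l := l')" V'] by simp
  moreover have n: "\<not> joined P l x j" "\<not> joined P j x l" "\<not> joined P' l' x j" "\<not> joined P' j x l'" for j x
    using joined_mem[OF J(1)] joined_mem[OF J(2)] p(2,3) by blast+
  have "joined (attach P' (\<sigma> p) a l') ((\<sigma>(l := l')) i) x ((\<sigma>(l := l')) j) \<longleftrightarrow> joined (attach P p a l) i x j"
    if "i \<in> insert l V" "j \<in> insert l V" for i j x
    using that m p n jj[of i j x]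
    unfolding joined_attach[OF J(1) p(1,2)] joined_attach[OF J(2) m(1)[OF p(1)] p(3)]
    by (cases "i = l"; cases "j = l") auto
  ultimately show ?thesis by (simp add: relabels_def)
qed

text \<open>Walks depend only on \<open>joined\<close>, so \<open>\<sigma>\<close> carries them
  over. As every walk has exactly one end, this gives the equivalence of gluings in both
  directions.\<close>

lemma relabels_isometric:
  assumes R: "relabels \<sigma> V P V' P'" and T: "cube_tree u V P" and T': "cube_tree u' V' P'"
  shows "isometric (surface_on V P) (surface_on V' P')"
proof -
  note B = cube_tree_basic[OF T] and B' = cube_tree_basic[OF T']
  have \<sigma>: "bij_betw \<sigma> V V'" and inj: "\<And>i j. i \<in> V \<Longrightarrow> j \<in> V \<Longrightarrow> \<sigma> i = \<sigma> j \<Longrightarrow> i = j" and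
    jj: "\<And>i j x. i \<in> V \<Longrightarrow> j \<in> V \<Longrightarrow> joined P' (\<sigma> i) x (\<sigma> j) \<longleftrightarrow> joined P i x j"
    using R by (auto simp: relabels_def bij_betw_def inj_on_def)
  have m: "i \<in> V \<Longrightarrow> \<sigma> i \<in> V'" for i using \<sigma> by (auto simp: bij_betw_def)
  have ex: "exposed P' (\<sigma> i) x \<longleftrightarrow> exposed P i x" if i: "i \<in> V" for i x
  proof -
    have "(\<exists>j. joined P' (\<sigma> i) x j) \<longleftrightarrow> (\<exists>j. joined P i x j)"
    proof
      assume "\<exists>j. joined P' (\<sigma> i) x j"
      then obtain j' where j': "joined P' (\<sigma> i) x j'" ..
      then have "j' \<in> V'" using joined_mem[OF B'(3)] by blast
      then obtain j where "j \<in> V" "j' = \<sigma> j" using \<sigma> by (auto simp: bij_betw_def)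
      then show "\<exists>j. joined P i x j" using jj[OF i] j' by blast
    next
      assume "\<exists>j. joined P i x j"
      then obtain j where j: "joined P i x j" ..
      then have "j \<in> V" using joined_mem[OF B(3)] by blast
      then show "\<exists>j. joined P' (\<sigma> i) x j" using jj[OF i] j by blast
    qed
    then show ?thesis by (simp add: exposed_def)
  qed
  have hinge: "hinge P' (\<sigma> (fst s), snd s) (\<sigma> (fst t), snd t)" if "hinge P s t" "fst s \<in> V" for s t
    using that
  proof (induction rule: hinge.induct)
    case (1 i b a)
    then show ?case using ex by (simp add: hinge.intros(1))
  next
    case (2 i b k a s)
    have k: "k \<in> V" using joined_mem[OF B(3) 2(1)] by blast
    then have "joined P' (\<sigma> i) b (\<sigma> k)" using jj[of i k b] 2 by simp
    moreover have "hinge P' (\<sigma> k, - b, a) (\<sigma> (fst s), snd s)" using 2 k by simp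
    ultimately show ?case by (simp add: hinge.intros(2))
  qed
  define f :: "flag \<Rightarrow> flag" where "f = (\<lambda>(i, x). (\<sigma> i, x))"
  have f: "f (i, a, b, e) = (\<sigma> i, a, b, e)" for i a b e by (simp add: f_def)
  have "inj_on f (flags (surface_on V P))"
  proof (rule inj_onI)
    fix x y assume "x \<in> flags (surface_on V P)" "y \<in> flags (surface_on V P)" "f x = f y"
    then show "x = y" using inj by (cases x, cases y) (auto simp: f flags_on)
  qed
  moreover have "f ` flags (surface_on V P) = flags (surface_on V' P')"
  proof (intro equalityI subsetI)
    fix y assume "y \<in> f ` flags (surface_on V P)"
    then obtain x where x: "x \<in> flags (surface_on V P)" "y = f x" by blast
    obtain i a b e where [simp]: "x = (i, a, b, e)" by (cases x)
    show "y \<in> flags (surface_on V' P')" using x ex m by (simp add: f flags_on)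
  next
    fix y assume y: "y \<in> flags (surface_on V' P')"
    obtain j a b e where [simp]: "y = (j, a, b, e)" by (cases y)
    have "j \<in> V'" using y by (simp add: flags_on)
    then obtain i where i: "i \<in> V" "j = \<sigma> i" using \<sigma> by (auto simp: bij_betw_def)
    then have "(i, a, b, e) \<in> flags (surface_on V P)" using y ex by (simp add: flags_on)
    then show "y \<in> f ` flags (surface_on V P)" using f[of i a b e] i(2) by (metis \<open>y = _\<close> image_eqI)
  qed
  moreover have "f (other_end x) = other_end (f x) \<and> f (other_side x) = other_side (f x)" for x
    by (cases x) (simp add: f)
  moreover have "(x, y) \<in> gluing (surface_on V P) \<longleftrightarrow> (f x, f y) \<in> gluing (surface_on V' P')"
    if xy: "x \<in> flags (surface_on V P)" "y \<in> flags (surface_on V P)" for x y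
  proof -
    obtain i a b e j c d e' where [simp]: "x = (i, a, b, e)" "y = (j, c, d, e')" by (cases x, cases y)
    have i: "i \<in> V" "exposed P i a" "perp a b" and j: "j \<in> V" using xy by (simp_all add: flags_on)
    obtain t where t: "hinge P (i, a, b) t" using hinge_total[OF T i] by blast
    have t': "hinge P' (\<sigma> i, a, b) (\<sigma> (fst t), snd t)" using hinge[OF t] i by simp
    have tV: "fst t \<in> V" using hinge_mem[OF t B(3)] i by simp
    have "hinge P (i, a, b) (j, c, d) \<longleftrightarrow> t = (j, c, d)" using hinge_unique[OF B(6) t] t by blast
    also have "\<dots> \<longleftrightarrow> (\<sigma> (fst t), snd t) = (\<sigma> j, c, d)" using inj[OF tV j] by (auto intro: prod_eqI)
    also have "\<dots> \<longleftrightarrow> hinge P' (\<sigma> i, a, b) (\<sigma> j, c, d)" using hinge_unique[OF B'(6) t'] t' by metis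
    finally show ?thesis using xy m[OF i(1)] ex[OF i(1)]
      by (simp add: f gluing_on[OF B(3)] gluing_on[OF B'(3)] flags_on)
  qed
  ultimately show ?thesis unfolding isometric_def bij_betw_def by (intro exI[of _ f]) blast
qed

section \<open>Sequences of moves\<close>

text \<open>A relation, so that its powers count steps; \<open>g\<close> is demanded at both ends
  and thus of every intermediate manifold.\<close>

definition refolds :: "nat \<Rightarrow> (polycube \<Rightarrow> bool) \<Rightarrow> polycube rel" where
  "refolds n g = {(P, Q). grid_refolding n P Q \<and> g P \<and> g Q}"

lemma refolding_seq_of_relpow:
  assumes "(P, Q) \<in> refolds n g ^^ k" "tree_shaped n P" "g P"
  shows "\<exists>M. grid_refolding_seq n k M P Q \<and> (\<forall>i\<le>k. g (M i))"
proof -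
  obtain M where M: "M 0 = P" "M k = Q" "\<And>i. i < k \<Longrightarrow> (M i, M (Suc i)) \<in> refolds n g"
    using assms(1) by (auto simp: relpow_fun_conv)
  have "tree_shaped n (M i) \<and> g (M i)" if "i \<le> k" for i
    using that assms(2,3) M(1) M(3)[of "i - 1"]
    by (cases i) (auto simp: refolds_def grid_refolding_def)
  then show ?thesis using M unfolding grid_refolding_seq_def refolds_def by blast
qed

text \<open>Nothing is cut and nothing glued: the isometry at the end of a refolding does all the
  work.\<close>

lemma refolds_relabels:
  assumes "relabels \<sigma> {..<n} P {..<n} Q" "cube_tree u {..<n} P" "cube_tree v {..<n} Q" "g P" "g Q"
  shows "(P, Q) \<in> refolds n g"
proof -
  let ?S = "surface_of n P"
  have "u < n" "v < n" using cube_tree_basic(2) assms(2,3) by blast+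
  then have "tree_shaped n P" "tree_shaped n Q" using assms(2,3) tree_shaped_iff by blast+
  moreover have "grid_cutting ?S ?S"
    using grid_manifold_on[OF assms(2)] by (simp add: grid_cutting_def surface_of_eq)
  moreover have "isometric ?S (surface_of n Q)"
    using relabels_isometric[OF assms(1-3)] by (simp add: surface_of_eq)
  ultimately show ?thesis
    using assms(4,5) unfolding refolds_def grid_refolding_def grid_gluing_def by blast
qed

lemma refolds_move:
  assumes T: "cube_tree u V P" and lV: "l \<notin> V" "insert l V = {..<n}"
    and adj: "((p, a), (q, c)) \<in> adjacent (surface_on V P)"
    and ok: "\<And>i x. i \<in> V \<Longrightarrow> x \<in> dirs \<Longrightarrow> exposed P i x \<Longrightarrow> g (attach P i x l)"
  shows "(attach P p a l, attach P q c l) \<in> refolds n g"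
proof -
  obtain b d where h: "p \<in> V" "exposed P p a" "perp a b" "hinge P (p, a, b) (q, c, d)"
    using adj by (auto simp: adjacent_on[OF cube_tree_basic(3)[OF T]])
  obtain e where e: "perp a e" "perp b e" using ex_perp2[OF h(3)] by blast
  interpret leaf_move u V P p a b q c d e l
    using T h e lV(1) by unfold_locales
  have "u < n" using cube_tree_basic(2)[OF tree1] lV(2) by blast
  then have "tree_shaped n P1" "tree_shaped n P2" using tree1 tree2 lV(2) tree_shaped_iff by metis+
  then have "grid_refolding n P1 P2"
    using refolding lV(2) unfolding grid_refolding_def surface_of_eq by metis
  moreover have "g P1" "g P2" using ok p q dirs by blast+
  ultimately show ?thesis by (simp add: refolds_def)
qed

text \<open>An adjacency is determined by a cube and two of the six directions, a face and its
  side.\<close>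

lemma card_adjacent:
  assumes T: "cube_tree u V P"
  shows "finite (adjacent (surface_on V P))" "card (adjacent (surface_on V P)) \<le> 36 * card V"
proof -
  note B = cube_tree_basic[OF T]
  define f where "f = (\<lambda>(i, x, y). case hinge_of P (i, x, y) of (j, z, w) \<Rightarrow> ((i, x), (j, z)))"
  have sub: "adjacent (surface_on V P) \<subseteq> f ` (V \<times> dirs \<times> dirs)"
  proof (rule subrelI)
    fix s t assume st: "(s, t) \<in> adjacent (surface_on V P)"
    obtain i x j y where [simp]: "s = (i, x)" "t = (j, y)" by (cases s, cases t)
    obtain v w where h: "i \<in> V" "perp x v" "hinge P (i, x, v) (j, y, w)"
      using st by (auto simp: adjacent_on[OF B(3)])
    have "f (i, x, v) = (s, t)" using hinge_of_eq[OF B(6) h(3)] by (simp add: f_def)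
    moreover have "(i, x, v) \<in> V \<times> dirs \<times> dirs" using h perp_dirs by blast
    ultimately show "(s, t) \<in> f ` (V \<times> dirs \<times> dirs)" by (metis image_eqI)
  qed
  have fin: "finite (V \<times> dirs \<times> dirs)" using B(1) finite_dirs by simp
  show "finite (adjacent (surface_on V P))" using finite_subset[OF sub] fin by simp
  have "card (V \<times> dirs \<times> dirs) = 36 * card V" by (simp add: card_cartesian_product card_dirs)
  then show "card (adjacent (surface_on V P)) \<le> 36 * card V"
    using surj_card_le[OF fin sub] by simp
qed

lemma refolds_roll:
  assumes T: "cube_tree u V P" and l: "l \<notin> V" "insert l V = {..<n}"
    and p: "p \<in> V" "a \<in> dirs" "exposed P p a" and q: "q \<in> V" "c \<in> dirs" "exposed P q c"
    and g: "\<And>i x. i \<in> V \<Longrightarrow> x \<in> dirs \<Longrightarrow> exposed P i x \<Longrightarrow> g (attach P i x l)"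
  shows "\<exists>m \<le> 36 * n. (attach P p a l, attach P q c l) \<in> refolds n g ^^ m"
proof -
  let ?A = "adjacent (surface_on V P)"
  have step: "(attach P (fst f) (snd f) l, attach P (fst h) (snd h) l) \<in> refolds n g ^^ m"
    if "(f, h) \<in> ?A ^^ m" for f h m
    using that
  proof (induction m arbitrary: h)
    case 0
    then show ?case by simp
  next
    case (Suc m)
    then obtain k where k: "(f, k) \<in> ?A ^^ m" "(k, h) \<in> ?A" by auto
    have "(attach P (fst k) (snd k) l, attach P (fst h) (snd h) l) \<in> refolds n g"
      by (rule refolds_move[OF T l]) (use k(2) g in auto)
    then show ?case using Suc.IH[OF k(1)] by auto
  qed
  have "((p, a), (q, c)) \<in> ?A\<^sup>*"
    using adjacent_connected[OF T] p q by (simp add: squares_on)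
  \<comment> \<open>Reachability in a finite relation takes at most as many steps as the relation
    has pairs.\<close>
  then obtain m where m: "m \<le> card ?A" "((p, a), (q, c)) \<in> ?A ^^ m"
    using rtrancl_finite_eq_relpow[OF card_adjacent(1)[OF T]] by blast
  have "card V \<le> n" using card_mono[of "{..<n}" V] l(2) by auto
  then have "m \<le> 36 * n" using m(1) card_adjacent(2)[OF T] by linarith
  then show ?thesis using step[OF m(2)] by auto
qed

section \<open>Towers\<close>

definition up :: vec where
  "up = (1, 0, 0)"

lemma up_dirs [simp]: "up \<in> dirs"
  by (simp add: up_def dirs_def)

lemma fst_up [simp]: "fst up = 1"
  by (simp add: up_def)

fun tower :: "polycube \<Rightarrow> nat \<Rightarrow> nat list \<Rightarrow> polycube" where
  "tower P t [] = P"
| "tower P t (l # ls) = tower (attach P t up l) l ls"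

definition topmost :: "polycube \<Rightarrow> nat set \<Rightarrow> nat \<Rightarrow> bool" where
  "topmost P V t \<longleftrightarrow> t \<in> V \<and> (\<forall>i\<in>V. fst (pos P i) \<le> fst (pos P t))"

text \<open>Freedom from self-intersections and slits, relative to a label set so that it passes to
  the tree without its leaf.\<close>

definition embedded :: "polycube \<Rightarrow> nat set \<Rightarrow> bool" where
  "embedded P V \<longleftrightarrow> inj_on (pos P) V \<and>
     (\<forall>i\<in>V. \<forall>j\<in>V. share_face (pos P i) (pos P j) \<longrightarrow> (i, j) \<in> joins P)"

lemma topmost_exposed:
  assumes "topmost P V t" "joins P \<subseteq> V \<times> V" shows "exposed P t up"
  unfolding exposed_def
proof
  assume "\<exists>j. joined P t up j"
  then obtain j where j: "joined P t up j" ..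
  then have "j \<in> V" "fst (pos P j) = fst (pos P t) + 1"
    using joined_mem[OF assms(2) j] by (simp_all add: joined_def)
  then show False using assms(1) by (fastforce simp: topmost_def)
qed

lemma topmost_attach:
  assumes "topmost P V t" "l \<notin> V" shows "topmost (attach P t up l) (insert l V) l"
proof -
  have "fst (pos P i) \<le> fst (pos P t) + 1" if "i \<in> V" for i
    using assms(1) that by (fastforce simp: topmost_def)
  then show ?thesis using assms(2) by (auto simp: topmost_def pos_attach)
qed

lemma cube_tree_attach_up:
  assumes "cube_tree u V P" "topmost P V t" "l \<notin> V"
  shows "cube_tree u (insert l V) (attach P t up l)"
  using assms topmost_exposed[OF assms(2) cube_tree_basic(3)[OF assms(1)]]
  by (intro cube_tree.leaf) (auto simp: topmost_def)

text \<open>No cube of \<open>V\<close> is higher than \<open>t\<close>, so the new place is empty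
  and only a cube at the place of \<open>t\<close> can touch it.\<close>

lemma embedded_attach_up:
  assumes S: "embedded P V" and t: "topmost P V t" and l: "l \<notin> V"
  shows "embedded (attach P t up l) (insert l V)"
proof -
  let ?Q = "attach P t up l"
  have tV: "t \<in> V" and le: "\<And>i. i \<in> V \<Longrightarrow> fst (pos P i) \<le> fst (pos P t)" and "t \<noteq> l"
    using t l by (auto simp: topmost_def)
  have inj: "inj_on (pos P) V" using S by (simp add: embedded_def)
  have pos: "pos ?Q i = pos P i" if "i \<in> V" for i using that l by (auto simp: pos_attach)
  have pl: "pos ?Q l = pos P t + up" by (simp add: pos_attach)
  have "inj_on (pos ?Q) (insert l V)"
  proof -
    have "inj_on (pos ?Q) V" using inj pos by (simp add: inj_on_def)
    moreover have "pos ?Q l \<noteq> pos ?Q i" if "i \<in> V" for i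
    proof
      assume "pos ?Q l = pos ?Q i"
      then have "fst (pos P t + up) = fst (pos P i)" using pos[OF that] pl by simp
      then show False using le[OF that] by simp
    qed
    then have "pos ?Q l \<notin> pos ?Q ` V" by blast
    ultimately show ?thesis using l by (simp add: inj_on_insert)
  qed
  moreover have "j = t" if j: "j \<in> V" "share_face (pos P j) (pos P t + up) \<or> share_face (pos P t + up) (pos P j)" for j
  proof -
    have "pos P j = pos P t"
      using j(2) le[OF j(1)] by (cases "pos P j"; cases "pos P t") (auto simp: share_face_def dirs_def up_def)
    then show ?thesis using inj_onD[OF inj _ j(1) tV] by simp
  qed
  moreover have "\<not> share_face v v" for v by (simp add: share_face_def dirs_def zero_prod_def)
  ultimately show ?thesis using S pos pl unfolding embedded_def joins_attach by auto
qed

lemma embedded_detach: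
  assumes "embedded (attach P p a l) (insert l V)" "l \<notin> V" shows "embedded P V"
proof -
  have pos: "pos (attach P p a l) i = pos P i" if "i \<in> V" for i using that assms(2) by (auto simp: pos_attach)
  show ?thesis using assms unfolding embedded_def
    by (auto simp: pos joins_attach inj_on_def)
qed

text \<open>A cube in front of the face would be joined to \<open>i\<close>, as there are no slits,
  and the face would not be exposed. Slits may arise here, hence the conclusion is only about
  overlaps.\<close>

lemma embedded_attach_inj:
  assumes "embedded P V" "i \<in> V" "x \<in> dirs" "exposed P i x" "l \<notin> V"
  shows "inj_on (pos (attach P i x l)) (insert l V)"
proof -
  let ?Q = "attach P i x l"
  have pos: "pos ?Q j = pos P j" if "j \<in> V" for j using that assms(5) by (auto simp: pos_attach)
  have "inj_on (pos ?Q) V" using assms(1) pos by (simp add: embedded_def inj_on_def)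
  moreover have "pos ?Q l \<notin> pos ?Q ` V"
  proof
    assume "pos ?Q l \<in> pos ?Q ` V"
    then obtain j where j: "j \<in> V" "pos ?Q l = pos ?Q j" by blast
    then have j: "j \<in> V" "pos P j = pos P i + x" using pos[OF j(1)] by (simp_all add: pos_attach)
    then have "(i, j) \<in> joins P" using assms by (auto simp: embedded_def share_face_def)
    then show False using j(2) assms(4) by (auto simp: exposed_def joined_def)
  qed
  ultimately show ?thesis using assms(5) by (simp add: inj_on_insert)
qed

text \<open>The last conjunct ensures that the face which carries the next leaf is still available
  when the tower stands.\<close>

lemma tower_props:
  assumes "cube_tree u V P" "topmost P V t" "distinct ls" "set ls \<inter> V = {}"
  shows "cube_tree u (V \<union> set ls) (tower P t ls) \<and> topmost (tower P t ls) (V \<union> set ls) (last (t # ls)) \<and>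
    (embedded P V \<longrightarrow> embedded (tower P t ls) (V \<union> set ls)) \<and>
    (\<forall>i\<in>V. \<forall>x. exposed P i x \<and> (i, x) \<noteq> (t, up) \<longrightarrow> exposed (tower P t ls) i x)"
  using assms
proof (induction ls arbitrary: P V t)
  case Nil
  then show ?case by simp
next
  case (Cons l ls)
  have l: "l \<notin> V" and tV: "t \<in> V" using Cons.prems by (auto simp: topmost_def)
  let ?Q = "attach P t up l"
  have "distinct ls" "set ls \<inter> insert l V = {}" using Cons.prems by auto
  note IH = Cons.IH[OF cube_tree_attach_up[OF Cons.prems(1,2) l] topmost_attach[OF Cons.prems(2) l] this]
  have "exposed (tower P t (l # ls)) i x" if "i \<in> V" "exposed P i x" "(i, x) \<noteq> (t, up)" for i x
  proof -
    have "i \<noteq> l" using that l by auto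
    then have "exposed ?Q i x"
      using that exposed_attach[OF cube_tree_basic(3)[OF Cons.prems(1)] tV l] by auto
    then show ?thesis using IH that(1) \<open>i \<noteq> l\<close> by simp
  qed
  then show ?case using IH embedded_attach_up[OF _ Cons.prems(2) l] by auto
qed

lemma attach_commute:
  assumes "l \<noteq> m" "p \<noteq> m" "t \<noteq> l"
  shows "attach (attach P p a l) t x m = attach (attach P t x m) p a l"
  using assms by (simp add: attach_def fun_upd_twist insert_commute)

text \<open>A leaf that was there before the tower may be regarded as attached after it, and can
  thus be moved while the tower stands.\<close>

lemma tower_attach:
  assumes "l \<notin> set ls" "p \<notin> set ls" "t \<noteq> l"
  shows "tower (attach P p a l) t ls = attach (tower P t ls) p a l"
  using assms by (induction ls arbitrary: P t) (simp_all add: attach_commute)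

lemma tower_snoc: "tower P t (ls @ [l]) = attach (tower P t ls) (last (t # ls)) up l"
  by (induction ls arbitrary: P t) auto

text \<open>The two parts of the theorem are proved together; c tells whether self-intersections are forbidden.\<close>

definition no_overlap :: "bool \<Rightarrow> nat \<Rightarrow> polycube \<Rightarrow> bool" where
  "no_overlap c n P \<longleftrightarrow> c \<longrightarrow> \<not> self_intersecting n P"

lemma no_overlap_inj: "(c \<Longrightarrow> inj_on (pos P) {..<n}) \<Longrightarrow> no_overlap c n P"
  by (auto simp: no_overlap_def self_intersecting_def inj_on_def)

text \<open>Base, position and order of the labels are left open, since different trees produce
  different ones.\<close>

definition is_tower :: "nat \<Rightarrow> (polycube \<Rightarrow> bool) \<Rightarrow> polycube \<Rightarrow> bool" where
  "is_tower n g L \<longleftrightarrow> (\<exists>P0 u ls. joins P0 = {} \<and> L = tower P0 u ls \<and> distinct (u # ls) \<and> set (u # ls) = {..<n} \<and>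
     cube_tree u {..<n} L \<and> g L)"

text \<open>Induction over the part \<open>P\<close> not yet dismantled, for all towers
  \<open>ls\<close> already standing on it. The last leaf of \<open>P\<close> is rolled to the top,
  which turns \<open>ls\<close> into \<open>ls @ [l]\<close> at a cost of at most
  \<open>36 * n\<close> moves, and likewise for the way back.\<close>

lemma refolds_tower:
  assumes "cube_tree u V P" "topmost P V u" "distinct ls" "set ls \<inter> V = {}" "V \<union> set ls = {..<n}"
    and "c \<Longrightarrow> embedded P V"
  shows "\<exists>L k k'. is_tower n (no_overlap c n) L \<and> k \<le> 36 * n * card V \<and> k' \<le> 36 * n * card V \<and>
    (tower P u ls, L) \<in> refolds n (no_overlap c n) ^^ k \<and> (L, tower P u ls) \<in> refolds n (no_overlap c n) ^^ k'"
  using assms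
proof (induction arbitrary: ls)
  case (root P)
  let ?L = "tower P u ls" and ?g = "no_overlap c n"
  note tp = tower_props[OF cube_tree.root[OF root.hyps] root.prems(1-3)]
  have "cube_tree u {..<n} ?L" using tp root.prems(4) by simp
  moreover have "inj_on (pos ?L) ({u} \<union> set ls)" if c
    using tp root.prems(5)[OF that] unfolding embedded_def by blast
  then have "?g ?L" unfolding root.prems(4) by (rule no_overlap_inj)
  moreover have "distinct (u # ls)" "set (u # ls) = {..<n}" using root.prems by auto
  ultimately have "is_tower n ?g ?L" using root.hyps unfolding is_tower_def by blast
  moreover have "(?L, ?L) \<in> refolds n ?g ^^ 0" by simp
  ultimately show ?case by blast
next
  case (leaf V P p l a)
  let ?g = "no_overlap c n" and ?W = "V \<union> set ls"
  let ?X = "tower P u ls"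
  have V: "finite V" "u \<in> V" "joins P \<subseteq> V \<times> V" using cube_tree_basic[OF leaf(1)] by blast+
  have ul: "u \<noteq> l" using V(2) leaf(3) by auto
  have pos: "pos (attach P p a l) i = pos P i" if "i \<in> V" for i using that leaf(3) by (auto simp: pos_attach)
  have top: "topmost P V u" using leaf.prems(1) V(2) pos unfolding topmost_def by auto
  have ls: "distinct ls" "set ls \<inter> V = {}" "l \<notin> ?W" using leaf.prems(2,3) leaf(3) by auto
  have W: "insert l ?W = {..<n}" using leaf.prems(4) by auto
  note tp = tower_props[OF leaf(1) top ls(1,2)]
  \<comment> \<open>Otherwise \<open>l\<close> would be higher than the topmost cube
    \<open>u\<close>.\<close>
  have "(p, a) \<noteq> (u, up)"
  proof
    assume "(p, a) = (u, up)"
    then have "fst (pos (attach P p a l) l) = fst (pos P u) + 1" by (simp add: pos_attach)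
    then show False using leaf.prems(1) pos[OF V(2)] by (auto simp: topmost_def)
  qed
  then have pX: "exposed ?X p a" using tp leaf(2,5) by blast
  define t where "t = last (u # ls)"
  have t: "topmost ?X ?W t" using tp by (simp add: t_def)
  then have tX: "t \<in> ?W" "exposed ?X t up"
    using topmost_exposed[OF t] cube_tree_basic(3)[of u ?W ?X] tp by (auto simp: topmost_def)
  have emb: "c \<Longrightarrow> embedded P V" using leaf.prems(5) embedded_detach leaf(3) by blast
  \<comment> \<open>If \<open>c\<close> holds, \<open>?X\<close> has neither overlaps nor slits, so
    the place in front of each exposed face is empty.\<close>
  have ok: "?g (attach ?X i x l)" if "i \<in> ?W" "x \<in> dirs" "exposed ?X i x" for i x
    using embedded_attach_inj[OF _ that ls(3)] tp emb W by (intro no_overlap_inj) simp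
  have X: "cube_tree u ?W ?X" using tp by blast
  have pW: "p \<in> ?W" using leaf(2) by blast
  obtain m where m: "m \<le> 36 * n" "(attach ?X p a l, attach ?X t up l) \<in> refolds n ?g ^^ m"
    using refolds_roll[where g = ?g, OF X ls(3) W pW leaf(4) pX tX(1) up_dirs tX(2) ok] by blast
  \<comment> \<open>The way back is a roll of its own, with the two faces exchanged.\<close>
  obtain m' where m': "m' \<le> 36 * n" "(attach ?X t up l, attach ?X p a l) \<in> refolds n ?g ^^ m'"
    using refolds_roll[where g = ?g, OF X ls(3) W tX(1) up_dirs tX(2) pW leaf(4) pX ok] by blast
  have start: "tower (attach P p a l) u ls = attach ?X p a l"
    using tower_attach[of l ls p u P a] ls leaf(2) ul by auto
  have next_t: "attach ?X t up l = tower P u (ls @ [l])" by (simp add: tower_snoc t_def)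
  obtain L k k' where L: "is_tower n ?g L" "k \<le> 36 * n * card V" "k' \<le> 36 * n * card V"
    "(tower P u (ls @ [l]), L) \<in> refolds n ?g ^^ k" "(L, tower P u (ls @ [l])) \<in> refolds n ?g ^^ k'"
    using leaf.IH[of "ls @ [l]"] top ls W emb leaf(3) by (auto simp: insert_commute)
  have "(tower (attach P p a l) u ls, L) \<in> refolds n ?g ^^ (m + k)"
    using m(2) L(4) unfolding start next_t relpow_add by blast
  moreover have "(L, tower (attach P p a l) u ls) \<in> refolds n ?g ^^ (k' + m')"
    using m'(2) L(5) unfolding start next_t relpow_add by blast
  moreover have "card (insert l V) = Suc (card V)" using V(1) leaf(3) by simp
  ultimately show ?case using L(1-3) m(1) m'(1)
    by (intro exI[of _ L] exI[of _ "m + k"] exI[of _ "k' + m'"]) simp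
qed

lemma relabels_tower:
  assumes "length ls = length ls'" "relabels \<sigma> V P V' P'" "joins P \<subseteq> V \<times> V" "joins P' \<subseteq> V' \<times> V'" "t \<in> V"
    and "distinct ls" "distinct ls'" "set ls \<inter> V = {}" "set ls' \<inter> V' = {}"
  shows "\<exists>\<sigma>'. relabels \<sigma>' (V \<union> set ls) (tower P t ls) (V' \<union> set ls') (tower P' (\<sigma> t) ls')"
  using assms
proof (induction ls ls' arbitrary: \<sigma> V P V' P' t rule: list_induct2)
  case Nil
  then show ?case by auto
next
  case (Cons l ls l' ls')
  let ?\<sigma> = "\<sigma>(l := l')" and ?Q = "attach P t up l" and ?Q' = "attach P' (\<sigma> t) up l'"
  have l: "l \<notin> V" "l' \<notin> V'" using Cons.prems by auto
  have "\<sigma> t \<in> V'" using Cons.prems(1,4) by (auto simp: relabels_def bij_betw_def)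
  then have J: "joins ?Q \<subseteq> insert l V \<times> insert l V" "joins ?Q' \<subseteq> insert l' V' \<times> insert l' V'"
    using Cons.prems(2-4) by (auto simp: joins_attach)
  note R = relabels_attach[OF Cons.prems(1-4) l]
  show ?case using Cons.IH[OF R J, of l] Cons.prems(5-8) by auto
qed

text \<open>Towers of equal height differ only by labels and a translation, so a relabelling takes
  one to the other.\<close>

lemma refolds_towers:
  assumes "is_tower n g L" "is_tower n g L'"
  shows "(L, L') \<in> refolds n g"
proof -
  obtain P u ls where L: "joins P = {}" "L = tower P u ls" "distinct (u # ls)" "set (u # ls) = {..<n}"
    "cube_tree u {..<n} L" "g L" using assms(1) unfolding is_tower_def by blast
  obtain P' u' ls' where L': "joins P' = {}" "L' = tower P' u' ls'" "distinct (u' # ls')" "set (u' # ls') = {..<n}"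
    "cube_tree u' {..<n} L'" "g L'" using assms(2) unfolding is_tower_def by blast
  have "length (u # ls) = length (u' # ls')"
    using distinct_card[OF L(3)] distinct_card[OF L'(3)] L(4) L'(4) by simp
  then have len: "length ls = length ls'" by simp
  have "relabels (\<lambda>_. u') {u} P {u'} P'"
    using L(1) L'(1) by (simp add: relabels_def bij_betw_def joined_def)
  then obtain \<sigma> where "relabels \<sigma> ({u} \<union> set ls) L ({u'} \<union> set ls') L'"
    using relabels_tower[OF len, of "\<lambda>_. u'" "{u}" P "{u'}" P' u] L L' by auto
  then have "relabels \<sigma> {..<n} L {..<n} L'" using L(4) L'(4) by simp
  then show ?thesis using refolds_relabels L(5,6) L'(5,6) by blast
qed

section \<open>The quadratic bound and the theorem\<close>

lemma refolds_between:
  assumes "1 \<le> n" "tree_shaped n P" "tree_shaped n Q"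
    and "c \<Longrightarrow> embedded P {..<n}" "c \<Longrightarrow> embedded Q {..<n}"
  shows "\<exists>k. k \<le> 73 * n^2 \<and> (P, Q) \<in> refolds n (no_overlap c n) ^^ k"
proof -
  let ?R = "refolds n (no_overlap c n)"
  have ex_top: "\<exists>u. topmost X {..<n} u" for X
  proof -
    let ?M = "Max ((\<lambda>i. fst (pos X i)) ` {..<n})"
    have ne: "(\<lambda>i. fst (pos X i)) ` {..<n} \<noteq> {}" using assms(1) by (auto simp: lessThan_empty_iff)
    then have "?M \<in> (\<lambda>i. fst (pos X i)) ` {..<n}" by (intro Max_in) simp_all
    then obtain u where "u < n" "fst (pos X u) = ?M" by auto
    then show ?thesis by (intro exI[of _ u]) (simp add: topmost_def)
  qed
  obtain u where u: "topmost P {..<n} u" using ex_top by blast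
  obtain v where v: "topmost Q {..<n} v" using ex_top by blast
  have P: "cube_tree u {..<n} P" using tree_shaped_iff[of u n P] u assms(2) by (simp add: topmost_def)
  have Q: "cube_tree v {..<n} Q" using tree_shaped_iff[of v n Q] v assms(3) by (simp add: topmost_def)
  obtain L k where L: "is_tower n (no_overlap c n) L" "k \<le> 36 * n * n" "(P, L) \<in> ?R ^^ k"
    using refolds_tower[OF P u, of "[]" n c] assms(4) by auto
  obtain L' k' where L': "is_tower n (no_overlap c n) L'" "k' \<le> 36 * n * n" "(L', Q) \<in> ?R ^^ k'"
    using refolds_tower[OF Q v, of "[]" n c] assms(5) by auto
  have "(P, Q) \<in> ?R ^^ (k + (1 + k'))"
    using L(3) L'(3) refolds_towers[OF L(1) L'(1)] unfolding relpow_add by auto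
  \<comment> \<open>Two dismantlings, the second one reversed, of at most \<open>36 * n * n\<close>
    steps each, and one relabelling, which is at most \<open>n * n\<close> because
    \<open>1 \<le> n\<close>.\<close>
  moreover have "k + (1 + k') \<le> 73 * n^2"
  proof -
    have "1 \<le> n * n" using assms(1) by simp
    then show ?thesis using L(2) L'(2) unfolding power2_eq_square mult.assoc by linarith
  qed
  ultimately show ?thesis by blast
qed

lemma embedded_iff: "embedded P {..<n} \<longleftrightarrow> \<not> self_intersecting n P \<and> slit_free n P"
  by (auto simp: embedded_def self_intersecting_def slit_free_def inj_on_def)

theorem theorem5p1:
  shows "\<exists>K::nat. \<forall>n\<ge>1. \<forall>P Q. tree_shaped n P \<and> tree_shaped n Q \<longrightarrow>
     (\<exists>k M. k \<le> K * n^2 \<and> grid_refolding_seq n k M P Q) \<and>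
     (\<not> self_intersecting n P \<and> slit_free n P \<and> \<not> self_intersecting n Q \<and> slit_free n Q \<longrightarrow>
       (\<exists>k M. k \<le> K * n^2 \<and> grid_refolding_seq n k M P Q \<and>
          (\<forall>i\<le>k. \<not> self_intersecting n (M i))))"
proof (rule exI[of _ 73], intro allI impI)
  fix n :: nat and P Q :: polycube
  assume n: "1 \<le> n" and PQ: "tree_shaped n P \<and> tree_shaped n Q"
  have A: "\<exists>k M. k \<le> 73 * n^2 \<and> grid_refolding_seq n k M P Q"
  proof -
    obtain k where k: "k \<le> 73 * n^2" "(P, Q) \<in> refolds n (no_overlap False n) ^^ k"
      using refolds_between[of n P Q False] n PQ by auto
    then show ?thesis using refolding_seq_of_relpow[OF k(2)] PQ by (auto simp: no_overlap_def)
  qed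
  have B: "\<exists>k M. k \<le> 73 * n^2 \<and> grid_refolding_seq n k M P Q \<and> (\<forall>i\<le>k. \<not> self_intersecting n (M i))"
    if e: "\<not> self_intersecting n P \<and> slit_free n P \<and> \<not> self_intersecting n Q \<and> slit_free n Q"
  proof -
    obtain k where k: "k \<le> 73 * n^2" "(P, Q) \<in> refolds n (no_overlap True n) ^^ k"
      using refolds_between[of n P Q True] n PQ e embedded_iff by auto
    then show ?thesis
      using refolding_seq_of_relpow[OF k(2)] PQ e unfolding no_overlap_def by blast
  qed
  show "(\<exists>k M. k \<le> 73 * n^2 \<and> grid_refolding_seq n k M P Q) \<and>
     (\<not> self_intersecting n P \<and> slit_free n P \<and> \<not> self_intersecting n Q \<and> slit_free n Q \<longrightarrow>
       (\<exists>k M. k \<le> 73 * n^2 \<and> grid_refolding_seq n k M P Q \<and>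
          (\<forall>i\<le>k. \<not> self_intersecting n (M i))))"
    using A B by (intro conjI impI)
qed

end
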